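(* Let $n\ge 1$ and $m\ge n+1$ be integers. Let $K\in\mathbb{P}^n_m$ be of maximal volume product among polytopes with at most $m$ vertices, i.e. $\mathcal{P}(K)\ge\mathcal{P}(K')$ for every $K'\in\mathbb{P}^n_m$. Then $K$ is a simplicial polytope, i.e. every facet of $K$ is a simplex.
   Context: A convex body in $\mathbb{R}^n$ is a compact convex subset with nonempty interior; $|\cdot|$ denotes volume (Lebesgue measure). For a convex body $K\subset\mathbb{R}^n$ and $z\in\mathrm{int}(K)$, the polar body of $K$ with center of polarity $z$ is $K^z=\{y\in\mathbb{R}^n:\langle y-z,x-z\rangle\le 1\ \text{for all } x\in K\}$. The volume product of $K$ is $\mathcal{P}(K)=\inf\{|K|\,|K^z|: z\in\mathrm{int}(K)\}$. For $m\ge n+1$, $\mathbb{P}^n_m$ denotes the set of polytopes in $\mathbb{R}^n$ with nonempty interior having at most $m$ vertices. *)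

theory Defs
  imports "HOL-Analysis.Analysis"
begin

definition polar_body :: "(real^'n) set \<Rightarrow> real^'n \<Rightarrow> (real^'n) set" where
  "polar_body K z = {y. \<forall>x\<in>K. (y - z) \<bullet> (x - z) \<le> 1}"

text \<open>
  For a convex body \<open>K\<close> and \<open>z\<close> in its interior, the polar body is compact, so its real-valued
  Lebesgue measure is its volume; and the infimum is over a nonempty set of nonnegative reals, so
  the real-valued \<^const>\<open>Inf\<close> is the true infimum.
\<close>

definition volume_product :: "(real^'n) set \<Rightarrow> real" where
  "volume_product K =
     (INF z\<in>interior K. measure lebesgue K * measure lebesgue (polar_body K z))"

definition polytopes_at_most :: "nat \<Rightarrow> (real^'n) set set" where
  "polytopes_at_most m =
     {K. polytope K \<and> interior K \<noteq> {} \<and> card {v. v extreme_point_of K} \<le> m}"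

definition simplicial_polytope :: "(real^'n) set \<Rightarrow> bool" where
  "simplicial_polytope K \<longleftrightarrow>
     polytope K \<and> (\<forall>F. F facet_of K \<longrightarrow> (\<exists>d. d simplex F))"

end

theory Submission
  imports Defs "HOL-Probability.Distributions"
begin

text \<open>
  Suppose that some facet of a maximal polytope \<open>K\<close> is not a simplex. Its vertices are affinely
  dependent, so one of them, \<open>v\<close>, lies in the affine hull of the others. Let \<open>K t\<close> be the polytope
  obtained from \<open>K\<close> by replacing \<open>v\<close> by \<open>v + t *\<^sub>R a\<close>, where \<open>a\<close> is the outer normal of the facet,
  and keeping the other vertices. It has no more vertices than \<open>K\<close>, for \<open>t\<close> of either sign. The
  contradiction comes from comparing the two factors of the volume product at \<open>t = 0\<close>: the volume
  has a convex kink, while the polar volume is differentiable as far as lower bounds are concerned.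

  \<^item> Volume. A point in the relative interior of the hull of the other vertices of the facet is a
    convex combination of vertices both with and without \<open>v\<close>. Pushing \<open>v\<close> outwards lifts such points, pushing \<open>v\<close> inwards
    does not lower them. Comparing chords parallel to \<open>a\<close> gives
    \<open>|K t| + |K (- t)| \<ge> 2 |K| + \<kappa> t\<close> with \<open>\<kappa> > 0\<close> (\<open>measure_convex_hull_insert_kink\<close>).

  \<^item> Polar volume. Writing \<open>h\<close> for the support function, \<open>n!\<close> times the volume of the polar of \<open>K\<close>
    about \<open>z\<close> is the integral of \<open>exp (z \<bullet> y - h y)\<close> over \<open>y\<close> (\<open>measure_polar_body\<close>). It has a
    minimiser \<open>z0\<close> in the interior (\<open>polar_weight_integral_minimiser\<close>), where the first moment of
    the integrand vanishes (\<open>polar_weight_first_moment\<close>). With \<open>exp x \<ge> 1 + x\<close> this bounds the polar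
    volume of \<open>K t\<close> from below, simultaneously for all centers, by \<open>F0 - B t\<close> up to the factor
    \<open>n!\<close>, where \<open>F0\<close> is the minimum for \<open>K\<close> and \<open>B t\<close> is the integral of the change of the support
    function against the weight at \<open>z0\<close> (\<open>polar_weight_integral_ge\<close>). The support function
    \<open>max (h_L y) ((v + t *\<^sub>R a) \<bullet> y)\<close>, with \<open>h_L\<close> that of the hull of the other vertices, is affine
    in \<open>t\<close> near \<open>0\<close> for almost every \<open>y\<close>, so \<open>B t + B (- t)\<close> is of smaller order than \<open>t\<close>
    (\<open>moved_vertex_dual_smooth\<close>).

  Maximality gives \<open>|K t| (F0 - B t) \<le> |K| F0\<close> for all \<open>t\<close>. Adding these inequalities for \<open>t\<close> and
  \<open>- t\<close> contradicts the kink as \<open>t\<close> tends to \<open>0\<close> (\<open>no_kink_of_bounded_product\<close>).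
\<close>

section \<open>Support functions and exponential integrals\<close>

definition support_fun :: "'a::euclidean_space set \<Rightarrow> 'a \<Rightarrow> real" where
  "support_fun K y = (SUP x\<in>K. x \<bullet> y)"

lemma bdd_above_inner_image:
  fixes K :: "'a::euclidean_space set"
  assumes "compact K"
  shows "bdd_above ((\<lambda>x. x \<bullet> y) ` K)"
  by (intro bounded_imp_bdd_above compact_imp_bounded compact_continuous_image assms continuous_intros)

lemma inner_le_support_fun:
  assumes "compact K" "x \<in> K"
  shows "x \<bullet> y \<le> support_fun K y"
  unfolding support_fun_def by (intro cSUP_upper assms bdd_above_inner_image)

lemma support_fun_le:
  assumes "K \<noteq> {}" "\<And>x. x \<in> K \<Longrightarrow> x \<bullet> y \<le> c"
  shows "support_fun K y \<le> c"
  unfolding support_fun_def by (intro cSUP_least assms)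

lemma support_fun_attained:
  assumes "compact K" "K \<noteq> {}"
  obtains x where "x \<in> K" "support_fun K y = x \<bullet> y"
proof -
  have "\<exists>x\<in>K. \<forall>w\<in>K. w \<bullet> y \<le> x \<bullet> y"
    by (intro continuous_attains_sup assms continuous_intros)
  then show thesis
    using that inner_le_support_fun[OF assms(1)] support_fun_le[OF assms(2)] by (meson order_antisym)
qed

lemma support_fun_scaleR:
  assumes "compact K" "K \<noteq> {}" "c \<ge> 0"
  shows "support_fun K (c *\<^sub>R y) = c * support_fun K y"
proof (rule order_antisym)
  show "support_fun K (c *\<^sub>R y) \<le> c * support_fun K y"
    using assms by (intro support_fun_le) (auto intro!: mult_left_mono inner_le_support_fun)
  obtain x where "x \<in> K" "support_fun K y = x \<bullet> y"
    using support_fun_attained assms by blast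
  then show "c * support_fun K y \<le> support_fun K (c *\<^sub>R y)"
    using inner_le_support_fun[OF assms(1), of x "c *\<^sub>R y"] by simp
qed

lemma support_fun_add_le:
  assumes "compact K" "K \<noteq> {}"
  shows "support_fun K (y + y') \<le> support_fun K y + support_fun K y'"
  using assms by (intro support_fun_le) (auto simp: inner_right_distrib intro!: add_mono inner_le_support_fun)

lemma continuous_on_support_fun:
  assumes "compact K" "K \<noteq> {}"
  shows "continuous_on S (support_fun K)"
proof -
  have "convex_on UNIV (support_fun K)"
    unfolding convex_on_def
    using support_fun_add_le[OF assms] support_fun_scaleR[OF assms] by (metis convex_UNIV)
  then have "continuous_on UNIV (support_fun K)"
    by (intro convex_on_continuous) auto
  then show ?thesis
    using continuous_on_subset by blast
qed

lemma support_fun_insert: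
  assumes "compact L" "L \<noteq> {}"
  shows "support_fun (convex hull (insert v L)) y = max (support_fun L y) (v \<bullet> y)"
proof (rule order_antisym)
  let ?m = "max (support_fun L y) (v \<bullet> y)"
  have "convex {x. x \<bullet> y \<le> ?m}"
    using convex_halfspace_le[of y ?m] by (simp add: inner_commute)
  moreover have "insert v L \<subseteq> {x. x \<bullet> y \<le> ?m}"
    using inner_le_support_fun[OF assms(1)] by (auto intro: max.coboundedI1)
  ultimately have "convex hull (insert v L) \<subseteq> {x. x \<bullet> y \<le> ?m}"
    by (rule hull_minimal[rotated])
  then show "support_fun (convex hull (insert v L)) y \<le> ?m"
    by (intro support_fun_le) auto
  have c: "compact (convex hull (insert v L))"
    using assms by (intro compact_convex_hull compact_insert)
  obtain x where "x \<in> L" "support_fun L y = x \<bullet> y"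
    using support_fun_attained assms by blast
  then show "?m \<le> support_fun (convex hull (insert v L)) y"
    using inner_le_support_fun[OF c] by (auto intro!: hull_inc)
qed

lemma support_fun_ge_norm:
  assumes "compact K" "cball z r \<subseteq> K" "r > 0"
  shows "support_fun K y - z \<bullet> y \<ge> r * norm y"
proof (cases "y = 0")
  case True
  then show ?thesis
    using inner_le_support_fun[OF assms(1), of z y] assms subsetD[OF assms(2), of z] by auto
next
  case False
  have "z + (r / norm y) *\<^sub>R y \<in> K"
    using assms False by (intro subsetD[OF assms(2)]) (simp add: dist_norm)
  from inner_le_support_fun[OF assms(1) this, of y] show ?thesis
    using False by (simp add: inner_left_distrib dot_square_norm power2_eq_square)
qed

text \<open>
  Slicing by levels: \<open>exp (- p y)\<close> is the integral of \<open>exp (- s)\<close> over \<open>s \<ge> p y\<close>, so by Tonelli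
  the left-hand side is the integral of \<open>exp (- s)\<close> times the volume of the sublevel set
  \<open>{y. p y \<le> s}\<close>. By homogeneity that set is the \<open>s\<close>-dilate of \<open>{y. p y \<le> 1}\<close>, and the factor
  \<open>s ^ DIM('a)\<close> turns the remaining integral into a Gamma integral.
\<close>

lemma exp_layer_cake:
  fixes p :: "'a::euclidean_space \<Rightarrow> real"
  assumes cont: "continuous_on UNIV p" and nonneg: "\<And>y. p y \<ge> 0"
    and hom: "\<And>c y. c \<ge> 0 \<Longrightarrow> p (c *\<^sub>R y) = c * p y"
  shows "(\<integral>\<^sup>+ y. ennreal (exp (- p y)) \<partial>lborel) = ennreal (fact DIM('a)) * emeasure lborel {y. p y \<le> 1}"
proof -
  have [measurable]: "p \<in> borel_measurable borel"
    by (rule borel_measurable_continuous_onI[OF cont])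
  have tail: "(\<integral>\<^sup>+ s. ennreal (exp (- s)) * indicator {q..} s \<partial>lborel) = ennreal (exp (- q))" for q :: real
  proof -
    have "(\<integral>\<^sup>+ s. ennreal (exp (- s)) * indicator {q..} s \<partial>lborel) = ennreal (0 - (- exp (- q)))"
    proof (rule nn_integral_FTC_atLeast)
      show "((\<lambda>s::real. - exp (- s)) \<longlongrightarrow> 0) at_top"
        by (rule tendsto_eq_intros filterlim_compose[OF exp_at_bot] filterlim_uminus_at_bot_at_top | simp)+
    qed (auto intro!: derivative_eq_intros)
    then show ?thesis by simp
  qed
  have scale: "emeasure lborel {y. p y \<le> s} = ennreal (s ^ DIM('a)) * emeasure lborel {y. p y \<le> 1}"
    if "s > 0" for s
  proof -
    have "(\<lambda>y. s *\<^sub>R y + 0) ` {y. p y \<le> 1} = {y. p y \<le> s}"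
    proof safe
      fix y assume "p y \<le> s"
      then have "p (inverse s *\<^sub>R y) \<le> 1"
        using that by (subst hom) (simp_all add: field_simps)
      moreover have "y = s *\<^sub>R (inverse s *\<^sub>R y) + 0"
        using that by simp
      ultimately show "y \<in> (\<lambda>y. s *\<^sub>R y + 0) ` {y. p y \<le> 1}" by blast
    qed (use that hom in auto)
    then have "emeasure lebesgue {y. p y \<le> s} = ennreal (\<bar>s\<bar> ^ DIM('a)) * emeasure lebesgue {y. p y \<le> 1}"
      using emeasure_lebesgue_affine[of s 0 "{y. p y \<le> 1}"] by (simp add: ennreal_power)
    then show ?thesis
      using that by simp
  qed
  have "(\<integral>\<^sup>+ y. ennreal (exp (- p y)) \<partial>lborel)
      = (\<integral>\<^sup>+ y. (\<integral>\<^sup>+ s. ennreal (exp (- s)) * indicator {p y..} s \<partial>lborel) \<partial>lborel)"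
    by (simp add: tail)
  also have "\<dots> = (\<integral>\<^sup>+ s. (\<integral>\<^sup>+ y. ennreal (exp (- s)) * indicator {p y..} s \<partial>lborel) \<partial>lborel)"
    by (rule lborel_pair.Fubini') (simp add: indicator_def)
  also have "\<dots> = (\<integral>\<^sup>+ s. (\<integral>\<^sup>+ y. ennreal (exp (- s)) * indicator {y. p y \<le> s} y \<partial>lborel) \<partial>lborel)"
    by (intro nn_integral_cong) (auto simp: indicator_def)
  also have "\<dots> = (\<integral>\<^sup>+ s. ennreal (exp (- s)) * emeasure lborel {y. p y \<le> s} \<partial>lborel)"
    by (intro nn_integral_cong nn_integral_cmult_indicator) auto
  also have "\<dots> = (\<integral>\<^sup>+ s. (ennreal (s ^ DIM('a) * exp (- s)) * indicator {0..} s)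
                     * emeasure lborel {y. p y \<le> 1} \<partial>lborel)"
  proof (rule nn_integral_cong_AE)
    have "AE s in lborel. s \<noteq> (0::real)"
      by (rule AE_lborel_singleton)
    then show "AE s in lborel. ennreal (exp (- s)) * emeasure lborel {y. p y \<le> s} =
        (ennreal (s ^ DIM('a) * exp (- s)) * indicator {0..} s) * emeasure lborel {y. p y \<le> 1}"
    proof eventually_elim
      case (elim s)
      show ?case
      proof (cases "s > 0")
        case True
        then have "ennreal (s ^ DIM('a) * exp (- s)) = ennreal (exp (- s)) * ennreal (s ^ DIM('a))"
          by (simp add: ennreal_mult mult.commute)
        with True show ?thesis
          by (simp add: scale[OF True] mult.assoc)
      next
        case False
        then have "{y. p y \<le> s} = {}"
          using elim by (auto simp: not_le intro: less_le_trans[OF _ nonneg])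
        then show ?thesis
          using False elim by simp
      qed
    qed
  qed
  also have "\<dots> = ennreal (fact DIM('a)) * emeasure lborel {y. p y \<le> 1}"
    by (subst nn_integral_multc) (auto simp: nn_intergal_power_times_exp_Ici)
  finally show ?thesis .
qed

section \<open>Volume of the polar body as a Laplace transform\<close>

text \<open>
  Up to the factor \<open>exp (z \<bullet> y)\<close> this is the exponential of minus the support function; its
  integral in \<open>y\<close> is \<open>n!\<close> times the volume of the polar of \<open>K\<close> about \<open>z\<close> (see
  \<open>measure_polar_body\<close> below). It depends on the center only through an exponential of a linear
  function, which is what makes first-order arguments in \<open>z\<close> so simple.
\<close>

definition polar_weight :: "'a::euclidean_space set \<Rightarrow> 'a \<Rightarrow> 'a \<Rightarrow> real" where
  "polar_weight K z y = exp (z \<bullet> y - support_fun K y)"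

lemma polar_weight_pos [simp]: "polar_weight K z y > 0"
  by (simp add: polar_weight_def)

lemma polar_weight_nonneg [simp]: "polar_weight K z y \<ge> 0"
  by (simp add: polar_weight_def)

lemma borel_measurable_support_fun:
  assumes "compact K" "K \<noteq> {}"
  shows "support_fun K \<in> borel_measurable borel"
  by (rule borel_measurable_continuous_onI[OF continuous_on_support_fun[OF assms]])

lemma borel_measurable_polar_weight:
  assumes "compact K" "K \<noteq> {}"
  shows "polar_weight K z \<in> borel_measurable borel"
proof -
  note borel_measurable_support_fun[OF assms, measurable]
  show ?thesis
    unfolding polar_weight_def[abs_def] by measurable
qed

text \<open>
  A ball of radius \<open>c\<close> about \<open>z\<close> inside \<open>K\<close> forces exponential decay at rate \<open>c\<close>. All integrability
  and domination arguments rest on this bound, which is uniform in \<open>z\<close> as long as the radius is.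
\<close>

lemma polar_weight_le_exp:
  assumes "compact K" "cball z c \<subseteq> K" "c > 0"
  shows "polar_weight K z y \<le> exp (- c * norm y)"
  using support_fun_ge_norm[OF assms, of y] by (simp add: polar_weight_def)

lemma integrable_exp_norm:
  assumes "c > 0"
  shows "integrable lborel (\<lambda>y::'a::euclidean_space. exp (- c * norm y))"
proof (rule integrableI_nonneg)
  have "{y::'a. c * norm y \<le> 1} = cball 0 (1 / c)"
    using assms by (auto simp: field_simps)
  moreover have "(\<integral>\<^sup>+ y. ennreal (exp (- (c * norm (y::'a)))) \<partial>lborel)
      = ennreal (fact DIM('a)) * emeasure lborel {y::'a. c * norm y \<le> 1}"
    using assms by (intro exp_layer_cake) (auto intro!: continuous_intros)
  ultimately show "(\<integral>\<^sup>+ y. ennreal (exp (- c * norm (y::'a))) \<partial>lborel) < \<infinity>"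
    using emeasure_lborel_cball_finite[of "0::'a" "1 / c"]
    by (simp add: ennreal_mult_less_top)
qed auto

lemma integrable_norm_times_exp_norm:
  assumes "c > 0"
  shows "integrable lborel (\<lambda>y::'a::euclidean_space. norm y * exp (- c * norm y))"
proof (rule Bochner_Integration.integrable_bound)
  show "integrable lborel (\<lambda>y::'a. (2 / c) * exp (- (c / 2) * norm y))"
    using assms by (intro integrable_mult_right integrable_exp_norm) auto
  have "norm y * exp (- c * norm y) \<le> (2 / c) * exp (- (c / 2) * norm y)" for y :: 'a
  proof -
    have "c / 2 * norm y \<le> exp (c / 2 * norm y)"
      using exp_ge_add_one_self[of "c / 2 * norm y"] by linarith
    then have "norm y \<le> (2 / c) * exp (c / 2 * norm y)"
      using assms by (simp add: field_simps)
    then have "norm y * exp (- c * norm y) \<le> (2 / c) * exp (c / 2 * norm y) * exp (- c * norm y)"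
      by (intro mult_right_mono) auto
    also have "\<dots> = (2 / c) * exp (- (c / 2) * norm y)"
      by (simp add: mult.assoc flip: exp_add)
    finally show ?thesis .
  qed
  then show "AE y::'a in lborel. norm (norm y * exp (- c * norm y)) \<le> norm ((2 / c) * exp (- (c / 2) * norm y))"
    using assms by auto
qed auto

lemma obtain_cball_in_interior:
  fixes K :: "'a::euclidean_space set"
  assumes "z \<in> interior K"
  obtains c where "c > 0" "cball z c \<subseteq> K"
  using assms unfolding mem_interior_cball by blast

lemma integrable_polar_weight:
  assumes "compact K" "z \<in> interior K"
  shows "integrable lborel (polar_weight K z)"
proof -
  obtain c where c: "c > 0" "cball z c \<subseteq> K"
    by (rule obtain_cball_in_interior[OF assms(2)])
  have "K \<noteq> {}" using assms interior_subset by blast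
  then show ?thesis
    using polar_weight_le_exp[OF assms(1) c(2,1)] borel_measurable_polar_weight[OF assms(1)]
    by (intro Bochner_Integration.integrable_bound[OF integrable_exp_norm[OF c(1)]])
      (auto simp: abs_of_pos)
qed

lemma integrable_times_polar_weight:
  fixes f :: "'a::euclidean_space \<Rightarrow> real"
  assumes "compact K" "z \<in> interior K" and [measurable]: "f \<in> borel_measurable borel"
    and f: "\<And>y. \<bar>f y\<bar> \<le> C * norm y"
  shows "integrable lborel (\<lambda>y. f y * polar_weight K z y)"
proof -
  obtain c where c: "c > 0" "cball z c \<subseteq> K"
    by (rule obtain_cball_in_interior[OF assms(2)])
  have "K \<noteq> {}" using assms interior_subset by blast
  note borel_measurable_polar_weight[OF assms(1) this, measurable]
  show ?thesis
  proof (rule Bochner_Integration.integrable_bound)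
    show "integrable lborel (\<lambda>y::'a. C * (norm y * exp (- c * norm y)))"
      by (intro integrable_mult_right integrable_norm_times_exp_norm c)
    have "\<bar>f y\<bar> * polar_weight K z y \<le> (C * norm y) * exp (- c * norm y)" for y
      using f[of y] by (intro mult_mono polar_weight_le_exp assms c)
        (auto intro: less_imp_le order_trans[OF abs_ge_zero])
    then show "AE y in lborel. norm (f y * polar_weight K z y) \<le> norm (C * (norm y * exp (- c * norm y)))"
      by (intro AE_I2) (metis abs_ge_self abs_mult abs_of_pos mult.assoc order_trans polar_weight_pos real_norm_def)
  qed measurable
qed

lemma abs_support_fun_le:
  fixes K :: "'a::euclidean_space set"
  assumes "compact K" "K \<noteq> {}"
  obtains R where "\<And>y. \<bar>support_fun K y\<bar> \<le> R * norm y"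
proof -
  obtain R where R: "\<And>x. x \<in> K \<Longrightarrow> norm x \<le> R"
    using assms compact_imp_bounded bounded_iff by metis
  have "\<bar>support_fun K y\<bar> \<le> R * norm y" for y
  proof -
    obtain x where x: "x \<in> K" "support_fun K y = x \<bullet> y"
      using support_fun_attained assms by blast
    show ?thesis
      unfolding x using Cauchy_Schwarz_ineq2[of x y] R[OF x(1)]
      by (meson mult_right_mono norm_ge_zero order_trans)
  qed
  then show thesis by (rule that)
qed

text \<open>
  The polar body about \<open>z\<close> is the translate by \<open>z\<close> of the unit sublevel set of the sublinear function
  \<open>support_fun K y - z \<bullet> y\<close>, so the layer-cake formula applies.
\<close>

lemma measure_polar_body:
  fixes K :: "(real^'n) set"
  assumes "compact K" "z \<in> interior K"
  shows "measure lebesgue (polar_body K z) = (\<integral>y. polar_weight K z y \<partial>lborel) / fact CARD('n)"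
proof -
  have ne: "K \<noteq> {}" "z \<in> K" using assms interior_subset by blast+
  let ?p = "\<lambda>y. support_fun K y - z \<bullet> y"
  have "polar_body K z = (+) z ` {y. ?p y \<le> 1}"
  proof -
    have iff: "(\<forall>x\<in>K. y \<bullet> (x - z) \<le> 1) \<longleftrightarrow> ?p y \<le> 1" for y
    proof
      assume *: "\<forall>x\<in>K. y \<bullet> (x - z) \<le> 1"
      have "support_fun K y \<le> 1 + z \<bullet> y"
        using * by (intro support_fun_le ne) (auto simp: inner_diff_right inner_commute)
      then show "?p y \<le> 1" by simp
    next
      assume "?p y \<le> 1"
      then show "\<forall>x\<in>K. y \<bullet> (x - z) \<le> 1"
        using inner_le_support_fun[OF assms(1), of _ y] by (force simp: inner_diff_right inner_commute)
    qed
    show ?thesis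
    proof (rule set_eqI)
      fix y
      have "y \<in> (+) z ` {y. ?p y \<le> 1} \<longleftrightarrow> ?p (y - z) \<le> 1"
        by (auto intro!: image_eqI[of _ _ "y - z"])
      then show "y \<in> polar_body K z \<longleftrightarrow> y \<in> (+) z ` {y. ?p y \<le> 1}"
        by (simp add: polar_body_def iff)
    qed
  qed
  then have "measure lebesgue (polar_body K z) = measure lebesgue {y. ?p y \<le> 1}"
    by (simp add: measure_translation)
  also have "\<dots> = measure lborel {y. ?p y \<le> 1}"
  proof -
    note borel_measurable_support_fun[OF assms(1) ne(1), measurable]
    show ?thesis by (intro measure_completion) measurable
  qed
  finally have m: "measure lebesgue (polar_body K z) = measure lborel {y. ?p y \<le> 1}" .
  have "(\<integral>\<^sup>+ y. ennreal (exp (- ?p y)) \<partial>lborel) = ennreal (fact DIM(real^'n)) * emeasure lborel {y. ?p y \<le> 1}"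
    using inner_le_support_fun[OF assms(1) ne(2)] support_fun_scaleR[OF assms(1) ne(1)]
    by (intro exp_layer_cake) (auto intro!: continuous_intros continuous_on_support_fun assms ne simp: algebra_simps)
  also have "(\<integral>\<^sup>+ y. ennreal (exp (- ?p y)) \<partial>lborel) = ennreal (\<integral>y. polar_weight K z y \<partial>lborel)"
    using integrable_polar_weight[OF assms]
    by (subst nn_integral_eq_integral[symmetric]) (auto simp: polar_weight_def less_imp_le)
  finally have "enn2real (ennreal (\<integral>y. polar_weight K z y \<partial>lborel)) =
      enn2real (ennreal (fact CARD('n)) * emeasure lborel {y. ?p y \<le> 1})" by simp
  then show ?thesis
    unfolding m by (simp add: enn2real_mult measure_def integral_nonneg_AE less_imp_le)
qed

section \<open>The Santalo point\<close>

text \<open>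
  Let \<open>a\<close> be an inner normal of a supporting hyperplane at the boundary point \<open>z\<close>. Subadditivity of the
  support function shows that the weight does not decrease under translation of its argument by \<open>- a\<close>.
  Were the integral finite, it would be unchanged by this translation, so the weight, being
  continuous, would be invariant under it; but the weight is \<open>1\<close> at the origin and smaller than \<open>1\<close>
  at \<open>a\<close>, because \<open>K\<close> is not contained in the supporting hyperplane.
\<close>

lemma nn_integral_polar_weight_boundary:
  fixes K :: "'a::euclidean_space set"
  assumes K: "compact K" "convex K" "interior K \<noteq> {}" and z: "z \<in> K" "z \<notin> interior K"
  shows "(\<integral>\<^sup>+ y. ennreal (polar_weight K z y) \<partial>lborel) = \<infinity>"
proof (rule ccontr)
  assume fin: "(\<integral>\<^sup>+ y. ennreal (polar_weight K z y) \<partial>lborel) \<noteq> \<infinity>"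
  let ?f = "polar_weight K z"
  have ne: "K \<noteq> {}" using z by auto
  note borel_measurable_polar_weight[OF K(1) ne, measurable]
  have ri: "rel_interior K = interior K"
    by (rule rel_interior_nonempty_interior[OF K(3)])
  obtain a where a: "a \<noteq> 0" "\<And>x. x \<in> K \<Longrightarrow> a \<bullet> z \<le> a \<bullet> x" "\<And>x. x \<in> interior K \<Longrightarrow> a \<bullet> z < a \<bullet> x"
    using supporting_hyperplane_rel_boundary[OF K(2) z(1), unfolded ri, OF z(2)] by metis
  obtain x where x: "x \<in> interior K" using K(3) by auto
  have less: "?f a < 1"
    using inner_le_support_fun[OF K(1) subsetD[OF interior_subset x], of a] a(3)[OF x]
    by (simp add: polar_weight_def inner_commute)
  have "support_fun K (- a) \<le> z \<bullet> (- a)"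
    using a(2) by (intro support_fun_le ne) (simp add: inner_commute)
  then have mono: "?f y \<le> ?f (y + (- a))" for y
    using support_fun_add_le[OF K(1) ne, of y "- a"] by (simp add: polar_weight_def algebra_simps)
  have int: "integrable lborel ?f"
    using fin by (intro integrableI_nonneg) (auto simp: less_top less_imp_le)
  have shift: "integrable lborel (\<lambda>y. ?f (y + (- a)))"
    "(\<integral>y. ?f (y + (- a)) \<partial>lborel) = (\<integral>y. ?f y \<partial>lborel)"
  proof -
    have d: "distr lborel borel (\<lambda>y. y + (- a)) = (lborel :: 'a measure)"
      using lborel_distr_plus[of "- a"] by (simp only: add.commute[of _ "- a"])
    have "integrable (distr lborel borel (\<lambda>y. y + (- a))) ?f" using int d by simp
    then show "integrable lborel (\<lambda>y. ?f (y + (- a)))"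
      by (subst (asm) integrable_distr_eq) auto
    have "(\<integral>y. ?f (y + (- a)) \<partial>lborel) = (\<integral>y. ?f y \<partial>distr lborel borel (\<lambda>y. y + (- a)))"
      by (subst integral_distr) auto
    then show "(\<integral>y. ?f (y + (- a)) \<partial>lborel) = (\<integral>y. ?f y \<partial>lborel)"
      using d by simp
  qed
  have cont: "continuous_on UNIV ?f"
    unfolding polar_weight_def[abs_def] by (intro continuous_intros continuous_on_support_fun K ne)
  have "continuous_on UNIV (\<lambda>y. y + (- a))"
    by (intro continuous_intros)
  then have "continuous_on UNIV (\<lambda>y. ?f (y + (- a)))"
    by (rule continuous_on_compose2[OF cont]) simp
  with cont have op: "open {y. ?f y < ?f (y + (- a))}"
    by (rule open_Collect_less)
  have "(\<integral>y. ?f (y + (- a)) - ?f y \<partial>lborel) = 0"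
    using shift int by simp
  then have "AE y in lborel. ?f (y + (- a)) - ?f y = 0"
    using mono shift int by (subst (asm) integral_nonneg_eq_0_iff_AE) auto
  then have "AE y in lborel. y \<notin> {y. ?f y < ?f (y + (- a))}"
    by (rule eventually_mono) simp
  then have "AE y in lebesgue. y \<notin> {y. ?f y < ?f (y + (- a))}"
    by (rule AE_completion)
  then have neg: "negligible {y. ?f y < ?f (y + (- a))}"
    unfolding negligible_iff_null_sets
    by (subst AE_iff_null_sets) (use op in \<open>auto intro: borel_open\<close>)
  then have "{y. ?f y < ?f (y + (- a))} = {}"
    using op open_not_negligible by blast
  then have "?f (a + (- a)) \<le> ?f a"
    by (metis (mono_tags, lifting) empty_Collect_eq not_less)
  moreover have "support_fun K 0 = 0"
    using support_fun_scaleR[OF K(1) ne, of 0 0] by simp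
  ultimately show False
    using less by (simp add: polar_weight_def)
qed

text \<open>
  A minimising sequence of centers has a limit point in the compact set \<open>K\<close>. Fatou's lemma bounds the
  integral at the limit by the infimum; in particular it is finite, so the limit is not on the
  boundary. The minimiser is the Santalo point of \<open>K\<close>.
\<close>

lemma polar_weight_integral_minimiser:
  fixes K :: "'a::euclidean_space set"
  assumes K: "compact K" "convex K" "interior K \<noteq> {}"
  obtains z0 where "z0 \<in> interior K"
    "\<And>z. z \<in> interior K \<Longrightarrow> (\<integral>y. polar_weight K z0 y \<partial>lborel) \<le> (\<integral>y. polar_weight K z y \<partial>lborel)"
proof -
  let ?F = "\<lambda>z. \<integral>y. polar_weight K z y \<partial>lborel"
  define I where "I = (INF z\<in>interior K. ?F z)"
  have ne: "K \<noteq> {}" using K(3) interior_subset by blast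
  note borel_measurable_polar_weight[OF K(1) ne, measurable]
  have bdd: "bdd_below (?F ` interior K)"
    by (rule bdd_belowI[of _ 0]) (auto intro!: integral_nonneg_AE simp: less_imp_le)
  have "\<exists>z\<in>interior K. ?F z < I + 1 / Suc n" for n
  proof -
    have "Inf (?F ` interior K) < I + 1 / Suc n" by (simp add: I_def)
    then show ?thesis
      using K(3) bdd by (subst (asm) cINF_less_iff) auto
  qed
  then obtain \<zeta> where \<zeta>: "\<And>n. \<zeta> n \<in> interior K" "\<And>n. ?F (\<zeta> n) < I + 1 / Suc n"
    by metis
  have "\<And>n. \<zeta> n \<in> K" using \<zeta>(1) interior_subset by blast
  then obtain l r where l: "l \<in> K" "strict_mono r" "(\<zeta> \<circ> r) \<longlonglongrightarrow> l"
    using K(1) unfolding compact_def by metis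
  have F_lim: "(\<lambda>n. ?F (\<zeta> (r n))) \<longlonglongrightarrow> I"
  proof (rule tendsto_sandwich)
    show "eventually (\<lambda>n. I \<le> ?F (\<zeta> (r n))) sequentially"
      unfolding I_def using \<zeta>(1) bdd by (auto intro!: always_eventually cINF_lower)
    show "eventually (\<lambda>n. ?F (\<zeta> (r n)) \<le> I + 1 / Suc (r n)) sequentially"
      using \<zeta>(2) by (auto intro!: always_eventually less_imp_le)
    have "(\<lambda>n. I + inverse (real (Suc n))) \<longlonglongrightarrow> I + 0"
      by (intro tendsto_intros LIMSEQ_inverse_real_of_nat)
    from LIMSEQ_subseq_LIMSEQ[OF this l(2)]
    show "(\<lambda>n. I + 1 / Suc (r n)) \<longlonglongrightarrow> I"
      by (simp add: o_def inverse_eq_divide)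
  qed auto
  have "(\<integral>\<^sup>+ y. ennreal (polar_weight K l y) \<partial>lborel)
      = (\<integral>\<^sup>+ y. liminf (\<lambda>n. ennreal (polar_weight K (\<zeta> (r n)) y)) \<partial>lborel)"
  proof (rule nn_integral_cong)
    fix y
    have "(\<lambda>n. ennreal (polar_weight K (\<zeta> (r n)) y)) \<longlonglongrightarrow> ennreal (polar_weight K l y)"
      using l(3) unfolding polar_weight_def o_def by (intro tendsto_intros) auto
    then show "ennreal (polar_weight K l y) = liminf (\<lambda>n. ennreal (polar_weight K (\<zeta> (r n)) y))"
      by (rule lim_imp_Liminf[OF sequentially_bot, symmetric])
  qed
  also have "\<dots> \<le> liminf (\<lambda>n. \<integral>\<^sup>+ y. ennreal (polar_weight K (\<zeta> (r n)) y) \<partial>lborel)"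
    by (intro nn_integral_liminf) measurable
  also have "\<dots> = liminf (\<lambda>n. ennreal (?F (\<zeta> (r n))))"
    using integrable_polar_weight[OF K(1) \<zeta>(1)]
    by (subst nn_integral_eq_integral) auto
  also have "\<dots> = ennreal I"
    using F_lim by (intro lim_imp_Liminf tendsto_ennrealI) auto
  finally have le: "(\<integral>\<^sup>+ y. ennreal (polar_weight K l y) \<partial>lborel) \<le> ennreal I" .
  have l_int: "l \<in> interior K"
  proof (rule ccontr)
    assume "l \<notin> interior K"
    from nn_integral_polar_weight_boundary[OF K l(1) this] le show False
      by (simp add: top_unique)
  qed
  have "I \<ge> 0"
    unfolding I_def using K(3) by (intro cINF_greatest) (auto intro!: integral_nonneg_AE less_imp_le)
  then have "?F l \<le> I"
    using le integrable_polar_weight[OF K(1) l_int]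
    by (subst (asm) nn_integral_eq_integral) (auto intro: less_imp_le)
  also have "I \<le> ?F z" if "z \<in> interior K" for z
    unfolding I_def using bdd that by (rule cINF_lower)
  finally show thesis using that l_int by blast
qed

text \<open>
  The first-order condition at the Santalo point: the gradient in \<open>z\<close> of the integral of the weight
  is the first moment of the weight. Convexity of the exponential gives a nonnegative moment
  at \<open>z0 + s *\<^sub>R e\<close> for small \<open>s > 0\<close>; dominated convergence carries this to \<open>z0\<close>, and replacing \<open>e\<close>
  by \<open>- e\<close> gives equality.
\<close>

lemma polar_weight_first_moment:
  fixes K :: "'a::euclidean_space set"
  assumes K: "compact K" and z0: "z0 \<in> interior K"
    and min: "\<And>z. z \<in> interior K \<Longrightarrow>
      (\<integral>y. polar_weight K z0 y \<partial>lborel) \<le> (\<integral>y. polar_weight K z y \<partial>lborel)"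
  shows "(\<integral>y. (e \<bullet> y) * polar_weight K z0 y \<partial>lborel) = 0"
proof -
  have ne: "K \<noteq> {}" using z0 interior_subset by blast
  note borel_measurable_polar_weight[OF K(1) ne, measurable]
  have ge: "(\<integral>y. (e \<bullet> y) * polar_weight K z0 y \<partial>lborel) \<ge> 0" for e :: 'a
  proof -
    obtain c' where c': "c' > 0" "cball z0 c' \<subseteq> K"
      by (rule obtain_cball_in_interior[OF z0])
    define c where "c = c' / 2"
    have c: "c > 0" "c' = c + c" using c' by (auto simp: c_def)
    \<comment> \<open>The steps keep every shifted center at distance at least \<open>c\<close> from the complement of \<open>K\<close>,
      so that one dominating function serves for all \<open>n\<close>.\<close>
    define s where "s n = c / (norm e + 1) * inverse (real (Suc n))" for n
    have s_pos: "s n > 0" for n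
      using c by (auto simp: s_def intro!: mult_pos_pos divide_pos_pos add_nonneg_pos)
    have s_le: "norm (s n *\<^sub>R e) \<le> c" for n
    proof -
      have "s n * norm e \<le> (c / (norm e + 1) * 1) * norm e"
        unfolding s_def using c by (intro mult_right_mono mult_left_mono) (auto simp: inverse_eq_divide)
      also have "\<dots> = c * norm e / (norm e + 1)"
        by simp
      also have "\<dots> \<le> c"
        by (subst pos_divide_le_eq) (use c in \<open>auto simp: add_nonneg_pos add_pos_nonneg algebra_simps\<close>)
      finally show ?thesis using s_pos[of n] by simp
    qed
    have sub: "cball (z0 + s n *\<^sub>R e) c \<subseteq> K" for n
    proof -
      have "cball (z0 + s n *\<^sub>R e) c \<subseteq> cball z0 c'"
        using s_le[of n] c(2) by (simp add: cball_subset_cball_iff dist_norm)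
      then show ?thesis using c' by blast
    qed
    have inK: "z0 + s n *\<^sub>R e \<in> interior K" for n
      using sub[of n] c(1) mem_interior_cball by blast
    have s0: "s \<longlonglongrightarrow> 0"
      unfolding s_def by (rule tendsto_mult_right_zero[OF LIMSEQ_inverse_real_of_nat])
    have "(\<lambda>n. \<integral>y. (e \<bullet> y) * polar_weight K (z0 + s n *\<^sub>R e) y \<partial>lborel)
        \<longlonglongrightarrow> (\<integral>y. (e \<bullet> y) * polar_weight K z0 y \<partial>lborel)"
    proof (rule integral_dominated_convergence)
      show "integrable lborel (\<lambda>y::'a. norm e * (norm y * exp (- c * norm y)))"
        by (intro integrable_mult_right integrable_norm_times_exp_norm c)
      show "AE y in lborel. (\<lambda>n. e \<bullet> y * polar_weight K (z0 + s n *\<^sub>R e) y)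
          \<longlonglongrightarrow> e \<bullet> y * polar_weight K z0 y"
      proof (rule AE_I2)
        fix y
        have "(\<lambda>n. z0 + s n *\<^sub>R e) \<longlonglongrightarrow> z0 + 0 *\<^sub>R e"
          by (intro tendsto_intros s0)
        then show "(\<lambda>n. e \<bullet> y * polar_weight K (z0 + s n *\<^sub>R e) y) \<longlonglongrightarrow> e \<bullet> y * polar_weight K z0 y"
          unfolding polar_weight_def by (intro tendsto_intros) auto
      qed
      show "AE y in lborel. norm (e \<bullet> y * polar_weight K (z0 + s n *\<^sub>R e) y)
          \<le> norm e * (norm y * exp (- c * norm y))" for n
      proof (rule AE_I2)
        fix y
        have "\<bar>e \<bullet> y\<bar> * polar_weight K (z0 + s n *\<^sub>R e) y \<le> (norm e * norm y) * exp (- c * norm y)"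
          by (intro mult_mono polar_weight_le_exp[OF K sub c(1)] Cauchy_Schwarz_ineq2) (auto intro: less_imp_le)
        then show "norm (e \<bullet> y * polar_weight K (z0 + s n *\<^sub>R e) y) \<le> norm e * (norm y * exp (- c * norm y))"
          by (simp add: abs_mult abs_of_pos mult.assoc)
      qed
    qed measurable
    moreover have "(\<integral>y. (e \<bullet> y) * polar_weight K (z0 + s n *\<^sub>R e) y \<partial>lborel) \<ge> 0" for n
    proof -
      let ?w = "polar_weight K (z0 + s n *\<^sub>R e)"
      have int: "integrable lborel ?w" "integrable lborel (polar_weight K z0)"
        "integrable lborel (\<lambda>y. (e \<bullet> y) * ?w y)"
        by (auto intro!: integrable_polar_weight integrable_times_polar_weight[where C = "norm e"] K inK z0 Cauchy_Schwarz_ineq2)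
      have "0 \<le> (\<integral>y. ?w y - polar_weight K z0 y \<partial>lborel)"
        using min[OF inK] int by simp
      also have "\<dots> \<le> (\<integral>y. s n * ((e \<bullet> y) * ?w y) \<partial>lborel)"
      proof (intro integral_mono integrable_mult_right Bochner_Integration.integrable_diff int)
        fix y
        have "1 + (- (s n * (e \<bullet> y))) \<le> exp (- (s n * (e \<bullet> y)))"
          by (rule exp_ge_add_one_self)
        then have "(1 - s n * (e \<bullet> y)) * ?w y \<le> exp (- (s n * (e \<bullet> y))) * ?w y"
          by (intro mult_right_mono) (auto intro: less_imp_le)
        also have "\<dots> = polar_weight K z0 y"
          by (simp add: polar_weight_def algebra_simps flip: exp_add)
        finally show "?w y - polar_weight K z0 y \<le> s n * ((e \<bullet> y) * ?w y)"
          by (simp add: algebra_simps)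
      qed
      finally show ?thesis
        using s_pos[of n] by (simp add: zero_le_mult_iff)
    qed
    ultimately show ?thesis
      by (intro LIMSEQ_le_const) auto
  qed
  from ge[of e] ge[of "- e"] show ?thesis by simp
qed

text \<open>
  The tangent inequality \<open>exp x \<ge> 1 + x\<close> compares the weight of another body \<open>K'\<close>, at an arbitrary
  center \<open>z\<close>, with the weight of \<open>K\<close> at its Santalo point. The term linear in \<open>z - z0\<close> integrates to
  zero by the first-order condition, so the lower bound does not depend on \<open>z\<close>. This replaces any
  discussion of how the Santalo point moves when the body is perturbed.
\<close>

lemma polar_weight_integral_ge:
  fixes K K' :: "'a::euclidean_space set"
  assumes K: "compact K" and z0: "z0 \<in> interior K"
    and crit: "\<And>e. (\<integral>y. (e \<bullet> y) * polar_weight K z0 y \<partial>lborel) = 0"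
    and K': "compact K'" and z: "z \<in> interior K'"
  shows "(\<integral>y. polar_weight K' z y \<partial>lborel) \<ge> (\<integral>y. polar_weight K z0 y \<partial>lborel)
     - (\<integral>y. (support_fun K' y - support_fun K y) * polar_weight K z0 y \<partial>lborel)"
proof -
  have ne: "K \<noteq> {}" "K' \<noteq> {}" using z0 z interior_subset by blast+
  note [measurable] = borel_measurable_support_fun[OF K ne(1)] borel_measurable_support_fun[OF K' ne(2)]
  obtain R where R: "\<And>y. \<bar>support_fun K y\<bar> \<le> R * norm y"
    using abs_support_fun_le[OF K ne(1)] by blast
  obtain R' where R': "\<And>y. \<bar>support_fun K' y\<bar> \<le> R' * norm y"
    using abs_support_fun_le[OF K' ne(2)] by blast
  have "\<bar>support_fun K' y - support_fun K y\<bar> \<le> (R' + R) * norm y" for y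
    using R[of y] R'[of y] by (simp add: algebra_simps)
  then have int: "integrable lborel (\<lambda>y. (support_fun K' y - support_fun K y) * polar_weight K z0 y)"
    by (intro integrable_times_polar_weight K z0) measurable
  have int': "integrable lborel (\<lambda>y. ((z - z0) \<bullet> y) * polar_weight K z0 y)"
    by (intro integrable_times_polar_weight[where C = "norm (z - z0)"] K z0 Cauchy_Schwarz_ineq2) measurable
  note int0 = integrable_polar_weight[OF K z0]
  have "(\<integral>y. polar_weight K z0 y + ((z - z0) \<bullet> y) * polar_weight K z0 y
        - (support_fun K' y - support_fun K y) * polar_weight K z0 y \<partial>lborel)
      \<le> (\<integral>y. polar_weight K' z y \<partial>lborel)"
  proof (rule integral_mono)
    fix y
    let ?x = "(z - z0) \<bullet> y - (support_fun K' y - support_fun K y)"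
    have "(1 + ?x) * polar_weight K z0 y \<le> exp ?x * polar_weight K z0 y"
      by (intro mult_right_mono exp_ge_add_one_self) (auto intro: less_imp_le)
    also have "\<dots> = polar_weight K' z y"
      by (simp add: polar_weight_def algebra_simps flip: exp_add)
    finally show "polar_weight K z0 y + ((z - z0) \<bullet> y) * polar_weight K z0 y
        - (support_fun K' y - support_fun K y) * polar_weight K z0 y \<le> polar_weight K' z y"
      by (simp add: algebra_simps)
  qed (use int int' int0 integrable_polar_weight[OF K' z] in auto)
  then show ?thesis
    using int int' int0 crit[of "z - z0"] by simp
qed

lemma measure_lebesgue_compact:
  "compact (K :: 'a::euclidean_space set) \<Longrightarrow> measure lebesgue K = measure lborel K"
  by (simp add: measure_completion borel_compact)

lemma volume_product_le:
  fixes K :: "(real^'n) set"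
  assumes "compact K" "z \<in> interior K"
  shows "volume_product K \<le> measure lborel K * ((\<integral>y. polar_weight K z y \<partial>lborel) / fact CARD('n))"
proof -
  have "volume_product K \<le> measure lebesgue K * measure lebesgue (polar_body K z)"
    unfolding volume_product_def using assms(2)
    by (intro cINF_lower bdd_belowI[of _ 0]) auto
  then show ?thesis
    using assms by (simp add: measure_polar_body measure_lebesgue_compact)
qed

lemma volume_product_ge:
  fixes K K' :: "(real^'n) set"
  assumes K: "compact K" and z0: "z0 \<in> interior K"
    and crit: "\<And>e. (\<integral>y. (e \<bullet> y) * polar_weight K z0 y \<partial>lborel) = 0"
    and K': "compact K'" "interior K' \<noteq> {}"
  shows "measure lborel K' * (((\<integral>y. polar_weight K z0 y \<partial>lborel)
      - (\<integral>y. (support_fun K' y - support_fun K y) * polar_weight K z0 y \<partial>lborel)) / fact CARD('n))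
    \<le> volume_product K'"
  unfolding volume_product_def
proof (rule cINF_greatest[OF K'(2)])
  fix z assume z: "z \<in> interior K'"
  show "measure lborel K' * (((\<integral>y. polar_weight K z0 y \<partial>lborel)
      - (\<integral>y. (support_fun K' y - support_fun K y) * polar_weight K z0 y \<partial>lborel)) / fact CARD('n))
    \<le> measure lebesgue K' * measure lebesgue (polar_body K' z)"
    using polar_weight_integral_ge[OF K z0 crit K'(1) z] K'(1) z
    by (auto simp: measure_polar_body measure_lebesgue_compact intro!: mult_left_mono divide_right_mono)
qed


section \<open>Moving a vertex: first-order behaviour of the polar volume\<close>

text \<open>
  A tie is possible only when \<open>v\<close> and some point of \<open>S\<close> have the same inner product with \<open>y\<close>, that is,
  on finitely many hyperplanes through the origin.
\<close>

lemma AE_support_fun_neq_inner: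
  fixes S :: "'a::euclidean_space set"
  assumes S: "finite S" "S \<noteq> {}" "v \<notin> S"
  shows "AE y in lborel. support_fun (convex hull S) y \<noteq> v \<bullet> y"
proof -
  have comp: "compact (convex hull S)" and ne: "convex hull S \<noteq> {}"
    using S by (auto intro: finite_imp_compact_convex_hull)
  have "AE y in lborel. (w - v) \<bullet> y \<noteq> 0" if "w \<in> S" for w
  proof -
    have "w - v \<noteq> 0" using that S(3) by auto
    then have "{y. (w - v) \<bullet> y = 0} \<in> null_sets lebesgue"
      using negligible_hyperplane negligible_iff_null_sets by blast
    then have "AE y in lebesgue. (w - v) \<bullet> y \<noteq> 0"
      by (rule AE_I') auto
    then show ?thesis by (simp add: AE_completion_iff)
  qed
  then have "AE y in lborel. \<forall>w\<in>S. (w - v) \<bullet> y \<noteq> 0"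
    using S(1) by (subst AE_ball_countable) (auto intro: countable_finite)
  then show ?thesis
  proof eventually_elim
    case (elim y)
    show ?case
    proof
      assume tie: "support_fun (convex hull S) y = v \<bullet> y"
      have "w \<bullet> y < v \<bullet> y" if "w \<in> S" for w
        using inner_le_support_fun[OF comp hull_inc[OF that], of y] elim that tie
        by (auto simp: inner_diff_left less_le)
      then have "S \<subseteq> {x. y \<bullet> x < v \<bullet> y}"
        by (auto simp: inner_commute)
      then have "convex hull S \<subseteq> {x. y \<bullet> x < v \<bullet> y}"
        by (rule hull_minimal) (rule convex_halfspace_lt)
      moreover obtain x where "x \<in> convex hull S" "support_fun (convex hull S) y = x \<bullet> y"
        by (rule support_fun_attained[OF comp ne])
      ultimately show False
        using tie by (auto simp: inner_commute)
    qed
  qed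
qed

lemma support_fun_moved_vertex_bound:
  "\<bar>max q ((v + t *\<^sub>R a) \<bullet> y) - max q (v \<bullet> y)\<bar> \<le> \<bar>t\<bar> * norm a * norm (y::'a::euclidean_space)"
proof -
  have "\<bar>max q ((v + t *\<^sub>R a) \<bullet> y) - max q (v \<bullet> y)\<bar> \<le> \<bar>t * (a \<bullet> y)\<bar>"
    by (auto simp: inner_add_left max_def abs_if)
  also have "\<dots> \<le> \<bar>t\<bar> * (norm a * norm y)"
    unfolding abs_mult by (intro mult_left_mono Cauchy_Schwarz_ineq2) auto
  finally show ?thesis by (simp add: mult.assoc)
qed

text \<open>
  When the vertex \<open>v\<close> is moved along \<open>a\<close>, the support function is the maximum of a fixed function and
  \<open>(v + t *\<^sub>R a) \<bullet> y\<close>. Away from ties this is affine in \<open>t\<close> near \<open>0\<close>, so its second difference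
  vanishes for small \<open>t\<close>. As ties form a null set and difference quotients are bounded by
  \<open>norm a * norm y\<close>, dominated convergence shows that \<open>B t + B (- t)\<close> is of smaller order than \<open>t\<close>:
  the polar volume has no kink at \<open>t = 0\<close>, whatever the facets at \<open>v\<close> look like.
\<close>

lemma moved_vertex_dual_smooth:
  fixes S :: "'a::euclidean_space set" and a :: 'a
  defines "h \<equiv> \<lambda>v. support_fun (convex hull (insert v (convex hull S)))"
  assumes S: "finite S" "S \<noteq> {}" "v \<notin> S"
    and K: "compact K" "z0 \<in> interior K"
  defines "B \<equiv> \<lambda>t. \<integral>y. (h (v + t *\<^sub>R a) y - h v y) * polar_weight K z0 y \<partial>lborel"
  shows "\<exists>C. \<forall>t. \<bar>B t\<bar> \<le> C * \<bar>t\<bar>"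
    and "(\<lambda>n. (B (inverse (Suc n)) + B (- inverse (Suc n))) / inverse (Suc n)) \<longlonglongrightarrow> 0"
proof -
  let ?L = "convex hull S"
  have comp: "compact ?L" and ne: "?L \<noteq> {}"
    using S by (auto intro: finite_imp_compact_convex_hull)
  have Kne: "K \<noteq> {}" using K interior_subset by blast
  note [measurable] = borel_measurable_polar_weight[OF K(1) Kne] borel_measurable_support_fun[OF comp ne]
  have h: "h v y = max (support_fun ?L y) (v \<bullet> y)" for v y
    unfolding h_def by (rule support_fun_insert[OF comp ne])
  have [measurable]: "h v \<in> borel_measurable borel" for v
    unfolding h[abs_def] by measurable
  have bound: "\<bar>h (v + t *\<^sub>R a) y - h v y\<bar> \<le> (\<bar>t\<bar> * norm a) * norm y" for t y
    unfolding h using support_fun_moved_vertex_bound by (simp add: mult.assoc)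
  let ?w = "polar_weight K z0"
  have int: "integrable lborel (\<lambda>y. (h (v + t *\<^sub>R a) y - h v y) * ?w y)" for t
    by (intro integrable_times_polar_weight[OF K _ bound]) measurable
  have intn: "integrable lborel (\<lambda>y. norm y * ?w y)"
    by (intro integrable_times_polar_weight[OF K, where C = 1]) auto
  have "\<bar>B t\<bar> \<le> (norm a * (\<integral>y. norm y * ?w y \<partial>lborel)) * \<bar>t\<bar>" for t
  proof -
    have "\<bar>B t\<bar> \<le> (\<integral>y. \<bar>(h (v + t *\<^sub>R a) y - h v y) * ?w y\<bar> \<partial>lborel)"
      unfolding B_def by (rule integral_abs_bound)
    also have "\<dots> \<le> (\<integral>y. (\<bar>t\<bar> * norm a) * (norm y * ?w y) \<partial>lborel)"
    proof (rule integral_mono)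
      fix y
      show "\<bar>(h (v + t *\<^sub>R a) y - h v y) * ?w y\<bar> \<le> (\<bar>t\<bar> * norm a) * (norm y * ?w y)"
        using mult_right_mono[OF bound polar_weight_nonneg, of t y K z0 y] by (simp add: abs_mult mult.assoc)
    qed (use int intn in auto)
    also have "\<dots> = (\<bar>t\<bar> * norm a) * (\<integral>y. norm y * ?w y \<partial>lborel)"
      by (rule integral_mult_right_zero)
    finally show ?thesis by (simp only: mult_ac)
  qed
  then show "\<exists>C. \<forall>t. \<bar>B t\<bar> \<le> C * \<bar>t\<bar>" by blast
  define s where "s n = inverse (real (Suc n))" for n
  have s: "s n > 0" for n by (simp add: s_def)
  have s0: "s \<longlonglongrightarrow> 0" unfolding s_def by (rule LIMSEQ_inverse_real_of_nat)
  define f where "f n y = ((h (v + s n *\<^sub>R a) y - h v y) + (h (v + (- s n) *\<^sub>R a) y - h v y)) / s n * ?w y" for n y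
  have "(\<lambda>n. \<integral>y. f n y \<partial>lborel) \<longlonglongrightarrow> (\<integral>y. 0 \<partial>(lborel :: 'a measure))"
  proof (rule integral_dominated_convergence)
    show "integrable lborel (\<lambda>y. (2 * norm a) * (norm y * ?w y))"
      by (intro integrable_mult_right intn)
    show "f n \<in> borel_measurable lborel" for n
      unfolding f_def[abs_def] by measurable
    show "AE y in lborel. norm (f n y) \<le> (2 * norm a) * (norm y * ?w y)" for n
    proof (rule AE_I2)
      fix y
      have "\<bar>((h (v + s n *\<^sub>R a) y - h v y) + (h (v + (- s n) *\<^sub>R a) y - h v y)) / s n\<bar> \<le> 2 * norm a * norm y"
        using bound[of "s n" y] bound[of "- s n" y] s[of n]
        by (simp add: abs_divide pos_divide_le_eq mult_ac)
      from mult_right_mono[OF this polar_weight_nonneg]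
      show "norm (f n y) \<le> (2 * norm a) * (norm y * ?w y)"
        by (simp add: f_def abs_mult mult.assoc)
    qed
    show "AE y in lborel. (\<lambda>n. f n y) \<longlonglongrightarrow> 0"
      using AE_support_fun_neq_inner[OF S]
    proof eventually_elim
      case (elim y)
      let ?d = "\<bar>support_fun ?L y - v \<bullet> y\<bar>"
      have "(\<lambda>n. s n * \<bar>a \<bullet> y\<bar>) \<longlonglongrightarrow> 0 * \<bar>a \<bullet> y\<bar>"
        by (intro tendsto_intros s0)
      then have "eventually (\<lambda>n. s n * \<bar>a \<bullet> y\<bar> < ?d) sequentially"
        using elim by (intro order_tendstoD) auto
      then have "eventually (\<lambda>n. f n y = 0) sequentially"
      proof eventually_elim
        case (elim n)
        have "\<bar>s n * (a \<bullet> y)\<bar> < ?d" using elim s[of n] by (simp add: abs_mult)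
        then have "(h (v + s n *\<^sub>R a) y - h v y) + (h (v + (- s n) *\<^sub>R a) y - h v y) = 0"
          unfolding h by (auto simp: inner_add_left inner_diff_left max_def abs_if split: if_splits)
        then show ?case by (simp add: f_def)
      qed
      then show ?case by (rule tendsto_eventually)
    qed
  qed auto
  moreover have "(\<integral>y. f n y \<partial>lborel) = (B (s n) + B (- s n)) / s n" for n
  proof -
    have "f n = (\<lambda>y. ((h (v + s n *\<^sub>R a) y - h v y) * ?w y + (h (v + (- s n) *\<^sub>R a) y - h v y) * ?w y) / s n)"
      by (auto simp: f_def fun_eq_iff add_divide_distrib algebra_simps)
    then show ?thesis
      using int[of "s n"] int[of "- s n"] unfolding B_def by simp
  qed
  ultimately show "(\<lambda>n. (B (inverse (Suc n)) + B (- inverse (Suc n))) / inverse (Suc n)) \<longlonglongrightarrow> 0"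
    by (simp add: s_def)
qed


section \<open>Moving a vertex: the kink of the volume\<close>

definition chord_length :: "'a::euclidean_space \<Rightarrow> 'a set \<Rightarrow> 'a \<Rightarrow> ennreal" where
  "chord_length a A x = emeasure lborel {s. x + s *\<^sub>R a \<in> A}"

text \<open>
  A coordinate-free form of Cavalieri's principle: the slab \<open>b \<le> l \<bullet> x \<le> b + 1\<close> meets every line in
  direction \<open>a\<close> in a segment of parameter length \<open>1\<close>. Integrating the chord lengths over the slab
  counts, after exchanging the order of integration and translating by \<open>s *\<^sub>R a\<close>, each point of \<open>A\<close>
  with weight \<open>1\<close>.
\<close>

lemma nn_integral_chord_length:
  fixes A :: "'a::euclidean_space set"
  assumes A: "A \<in> sets borel" and l: "l \<bullet> a = 1"
  shows "(\<integral>\<^sup>+ x. chord_length a A x * indicator {x. b \<le> l \<bullet> x \<and> l \<bullet> x \<le> b + 1} x \<partial>lborel)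
    = emeasure lborel A"
proof -
  note A[measurable]
  let ?S = "{x. b \<le> l \<bullet> x \<and> l \<bullet> x \<le> b + 1}"
  have "(\<integral>\<^sup>+ x. chord_length a A x * indicator ?S x \<partial>lborel)
      = (\<integral>\<^sup>+ x. (\<integral>\<^sup>+ s. indicator A (x + s *\<^sub>R a) * indicator ?S x \<partial>lborel) \<partial>lborel)"
  proof (rule nn_integral_cong)
    fix x
    have "chord_length a A x = (\<integral>\<^sup>+ s. indicator {s. x + s *\<^sub>R a \<in> A} s \<partial>lborel)"
      unfolding chord_length_def by (rule nn_integral_indicator[symmetric]) measurable
    also have "\<dots> = (\<integral>\<^sup>+ s. indicator A (x + s *\<^sub>R a) \<partial>lborel)"
      by (simp add: indicator_def)
    finally show "chord_length a A x * indicator ?S x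
        = (\<integral>\<^sup>+ s. indicator A (x + s *\<^sub>R a) * indicator ?S x \<partial>lborel)"
      by (simp add: nn_integral_multc)
  qed
  also have "\<dots> = (\<integral>\<^sup>+ s. (\<integral>\<^sup>+ x. indicator A (x + s *\<^sub>R a) * indicator ?S x \<partial>lborel) \<partial>lborel)"
    by (rule lborel_pair.Fubini') measurable
  also have "\<dots> = (\<integral>\<^sup>+ s. (\<integral>\<^sup>+ x. indicator A x * indicator ?S (x - s *\<^sub>R a) \<partial>lborel) \<partial>lborel)"
  proof (rule nn_integral_cong)
    fix s
    have "(\<integral>\<^sup>+ x. indicator A x * indicator ?S (x - s *\<^sub>R a) \<partial>lborel)
       = (\<integral>\<^sup>+ x. indicator A x * indicator ?S (x - s *\<^sub>R a) \<partial>distr lborel borel ((+) (s *\<^sub>R a)))"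
      by (simp add: lborel_distr_plus)
    also have "\<dots> = (\<integral>\<^sup>+ x. indicator A (s *\<^sub>R a + x) * indicator ?S (s *\<^sub>R a + x - s *\<^sub>R a) \<partial>lborel)"
      by (rule nn_integral_distr) measurable
    finally show "(\<integral>\<^sup>+ x. indicator A (x + s *\<^sub>R a) * indicator ?S x \<partial>lborel)
       = (\<integral>\<^sup>+ x. indicator A x * indicator ?S (x - s *\<^sub>R a) \<partial>lborel)"
      by (simp add: add.commute)
  qed
  also have "\<dots> = (\<integral>\<^sup>+ x. (\<integral>\<^sup>+ s. indicator A x * indicator ?S (x - s *\<^sub>R a) \<partial>lborel) \<partial>lborel)"
    by (rule lborel_pair.Fubini'[symmetric]) measurable
  also have "\<dots> = (\<integral>\<^sup>+ x. indicator A x \<partial>lborel)"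
  proof (rule nn_integral_cong)
    fix x
    have "(\<integral>\<^sup>+ s. indicator ?S (x - s *\<^sub>R a) \<partial>lborel)
        = (\<integral>\<^sup>+ s. indicator {l \<bullet> x - b - 1 .. l \<bullet> x - b} s \<partial>lborel)"
      using l by (intro nn_integral_cong) (auto simp: indicator_def inner_diff_right)
    also have "\<dots> = 1" by simp
    finally show "(\<integral>\<^sup>+ s. indicator A x * indicator ?S (x - s *\<^sub>R a) \<partial>lborel) = indicator A x"
      by (subst nn_integral_cmult) auto
  qed
  finally show ?thesis by simp
qed

lemma closed_chord:
  fixes A :: "'a::euclidean_space set"
  assumes "closed A"
  shows "closed {s. x + s *\<^sub>R a \<in> A}"
  using closed_vimage[OF assms, of "\<lambda>s. x + s *\<^sub>R a"]
  by (simp add: vimage_def continuous_intros)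

lemma chord_length_ge:
  assumes "convex A" "closed A" "x + \<alpha> *\<^sub>R a \<in> A" "x + \<beta> *\<^sub>R a \<in> A"
  shows "ennreal (\<beta> - \<alpha>) \<le> chord_length a A x"
proof (cases "\<alpha> \<le> \<beta>")
  case True
  have "{\<alpha>..\<beta>} \<subseteq> {s. x + s *\<^sub>R a \<in> A}"
  proof safe
    fix s assume s: "s \<in> {\<alpha>..\<beta>}"
    show "x + s *\<^sub>R a \<in> A"
    proof (cases "\<alpha> = \<beta>")
      case True
      then show ?thesis using s assms by auto
    next
      case False
      define u where "u = (s - \<alpha>) / (\<beta> - \<alpha>)"
      have u: "0 \<le> u" "u \<le> 1" "u * (\<beta> - \<alpha>) = s - \<alpha>"
        using s False by (auto simp: u_def)
      have "(1 - u) *\<^sub>R (x + \<alpha> *\<^sub>R a) + u *\<^sub>R (x + \<beta> *\<^sub>R a) \<in> A"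
        using assms u by (intro convexD) auto
      also have "(1 - u) *\<^sub>R (x + \<alpha> *\<^sub>R a) + u *\<^sub>R (x + \<beta> *\<^sub>R a) = x + (\<alpha> + u * (\<beta> - \<alpha>)) *\<^sub>R a"
        by (simp add: algebra_simps)
      finally show ?thesis using u(3) by simp
    qed
  qed
  moreover have "{s. x + s *\<^sub>R a \<in> A} \<in> sets borel"
    by (intro borel_closed closed_chord assms)
  ultimately have "emeasure lborel {\<alpha>..\<beta>} \<le> chord_length a A x"
    unfolding chord_length_def by (intro emeasure_mono) auto
  then show ?thesis using True by simp
qed (simp add: ennreal_neg)

lemma chord_endpoints:
  fixes A :: "'a::euclidean_space set"
  assumes A: "compact A" and l: "l \<bullet> a = 1" and ne: "x + s0 *\<^sub>R a \<in> A"
  obtains \<alpha> \<beta> where "x + \<alpha> *\<^sub>R a \<in> A" "x + \<beta> *\<^sub>R a \<in> A"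
    "\<And>s. x + s *\<^sub>R a \<in> A \<Longrightarrow> \<alpha> \<le> s \<and> s \<le> \<beta>" "chord_length a A x \<le> ennreal (\<beta> - \<alpha>)"
proof -
  let ?C = "{s. x + s *\<^sub>R a \<in> A}"
  have cl: "closed ?C"
    by (intro closed_chord compact_imp_closed A)
  have "?C \<subseteq> (\<lambda>p. l \<bullet> p - l \<bullet> x) ` A"
  proof
    fix s assume "s \<in> ?C"
    then show "s \<in> (\<lambda>p. l \<bullet> p - l \<bullet> x) ` A"
      using l by (intro image_eqI[of _ _ "x + s *\<^sub>R a"]) (auto simp: inner_add_right)
  qed
  moreover have "compact ((\<lambda>p. l \<bullet> p - l \<bullet> x) ` A)"
    by (intro compact_continuous_image A continuous_intros)
  ultimately have "compact ?C"
    using cl by (metis compact_Int_closed inf.absorb_iff2)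
  moreover have "?C \<noteq> {}" using ne by auto
  ultimately obtain \<alpha> \<beta> where ab: "\<alpha> \<in> ?C" "\<And>s. s \<in> ?C \<Longrightarrow> \<alpha> \<le> s" "\<beta> \<in> ?C" "\<And>s. s \<in> ?C \<Longrightarrow> s \<le> \<beta>"
    by (meson compact_attains_inf compact_attains_sup)
  have "chord_length a A x \<le> emeasure lborel {\<alpha>..\<beta>}"
    unfolding chord_length_def using ab by (intro emeasure_mono) auto
  then show thesis
    using ab by (intro that) auto
qed

text \<open>
  The lower end \<open>x + \<alpha> *\<^sub>R a\<close> of a chord of \<open>A\<close> is shifted by opposite amounts into \<open>Ap\<close> and \<open>Am\<close>, so it
  contributes nothing to the sum of the two chord lengths. The upper end is shifted by \<open>\<mu>\<close> and \<open>\<nu>\<close>,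
  and only the sum \<open>\<mu> + \<nu> = g\<close> is gained. With \<open>g = 0\<close> this is the convexity of chord lengths along
  a shadow system; a positive \<open>g\<close> records a strict gain.
\<close>

lemma chord_length_sum_ge:
  fixes A Ap Am :: "'a::euclidean_space set"
  assumes A: "compact A" and Ap: "convex Ap" "closed Ap" and Am: "convex Am" "closed Am"
    and l: "l \<bullet> a = 1" and ne: "x + s0 *\<^sub>R a \<in> A"
    and shift: "\<And>p. p \<in> A \<Longrightarrow> \<exists>k. p + k *\<^sub>R a \<in> Ap \<and> p - k *\<^sub>R a \<in> Am"
    and top: "\<And>p. p \<in> A \<Longrightarrow> (\<And>s. p + s *\<^sub>R a \<in> A \<Longrightarrow> s \<le> 0) \<Longrightarrow> (\<exists>s. p = x + s *\<^sub>R a) \<Longrightarrow>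
      \<exists>\<mu> \<nu>. p + \<mu> *\<^sub>R a \<in> Ap \<and> p + \<nu> *\<^sub>R a \<in> Am \<and> \<mu> + \<nu> = g"
    and g: "g \<ge> 0"
  shows "2 * chord_length a A x + ennreal g \<le> chord_length a Ap x + chord_length a Am x"
proof -
  obtain \<alpha> \<beta> where ab: "x + \<alpha> *\<^sub>R a \<in> A" "x + \<beta> *\<^sub>R a \<in> A"
    "\<And>s. x + s *\<^sub>R a \<in> A \<Longrightarrow> \<alpha> \<le> s \<and> s \<le> \<beta>" "chord_length a A x \<le> ennreal (\<beta> - \<alpha>)"
    using chord_endpoints[OF A l ne] by metis
  obtain k where lam: "x + \<alpha> *\<^sub>R a + k *\<^sub>R a \<in> Ap" "x + \<alpha> *\<^sub>R a - k *\<^sub>R a \<in> Am"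
    using shift[OF ab(1)] by blast
  have "\<exists>\<mu> \<nu>. x + \<beta> *\<^sub>R a + \<mu> *\<^sub>R a \<in> Ap \<and> x + \<beta> *\<^sub>R a + \<nu> *\<^sub>R a \<in> Am \<and> \<mu> + \<nu> = g"
  proof (rule top[OF ab(2)])
    fix s assume "x + \<beta> *\<^sub>R a + s *\<^sub>R a \<in> A"
    then show "s \<le> 0" using ab(3)[of "\<beta> + s"] by (simp add: algebra_simps)
  qed blast
  then obtain \<mu> \<nu> where mn: "x + \<beta> *\<^sub>R a + \<mu> *\<^sub>R a \<in> Ap" "x + \<beta> *\<^sub>R a + \<nu> *\<^sub>R a \<in> Am" "\<mu> + \<nu> = g"
    by blast
  have "ennreal ((\<beta> + \<mu>) - (\<alpha> + k)) \<le> chord_length a Ap x"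
    using mn lam by (intro chord_length_ge Ap) (auto simp: algebra_simps)
  moreover have "ennreal ((\<beta> + \<nu>) - (\<alpha> - k)) \<le> chord_length a Am x"
    using mn lam by (intro chord_length_ge Am) (auto simp: algebra_simps)
  moreover have "ennreal (2 * (\<beta> - \<alpha>) + g) \<le> ennreal ((\<beta> + \<mu>) - (\<alpha> + k)) + ennreal ((\<beta> + \<nu>) - (\<alpha> - k))"
  proof -
    have "2 * (\<beta> - \<alpha>) + g = ((\<beta> + \<mu>) - (\<alpha> + k)) + ((\<beta> + \<nu>) - (\<alpha> - k))"
      using mn(3) by simp
    then show ?thesis
      by (simp add: ennreal_plus_if ennreal_leI)
  qed
  moreover have "2 * chord_length a A x + ennreal g \<le> ennreal (2 * (\<beta> - \<alpha>) + g)"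
  proof -
    have "\<alpha> \<le> \<beta>" using ab by blast
    then have "ennreal (2 * (\<beta> - \<alpha>) + g) = 2 * ennreal (\<beta> - \<alpha>) + ennreal g"
      using g by (simp only: mult_2 ennreal_plus add_nonneg_nonneg diff_ge_0_iff_ge)
    then show ?thesis
      using ab(4) by (auto intro!: add_right_mono mult_left_mono)
  qed
  ultimately show ?thesis
    by (meson add_mono order_trans)
qed

text \<open>
  The number \<open>k\<close> is the weight of the apex \<open>v\<close> in a representation of \<open>p\<close>; keeping the weights while
  the apex moves along \<open>a\<close> moves \<open>p\<close> at the constant speed \<open>k\<close>.
\<close>

lemma convex_hull_insert_shift:
  assumes "convex L" "L \<noteq> {}" "p \<in> convex hull (insert v L)"
  shows "\<exists>k. \<forall>t. p + (t * k) *\<^sub>R a \<in> convex hull (insert (v + t *\<^sub>R a) L)"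
proof -
  obtain u w q where q: "0 \<le> u" "0 \<le> w" "u + w = 1" "q \<in> L" "p = u *\<^sub>R v + w *\<^sub>R q"
    using assms(3) unfolding convex_hull_insert[OF assms(2)] hull_same[of convex, OF assms(1)] by blast
  have "p + (t * u) *\<^sub>R a \<in> convex hull (insert (v + t *\<^sub>R a) L)" for t
  proof -
    have "u *\<^sub>R (v + t *\<^sub>R a) + w *\<^sub>R q \<in> convex hull (insert (v + t *\<^sub>R a) L)"
      using q by (intro convexD[OF convex_convex_hull]) (auto intro: hull_inc)
    then show ?thesis by (simp add: q(5) algebra_simps)
  qed
  then show ?thesis by blast
qed

text \<open>
  The cone over \<open>G\<close> with apex \<open>x0 + a\<close> is full-dimensional, hence contains a ball, and projects along \<open>a\<close>
  into \<open>G\<close>. Halving towards \<open>x0\<close> gives a ball over the set of midpoints of \<open>x0\<close> with \<open>G\<close>. These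
  midpoints matter because they inherit from \<open>x0\<close> half of any weight that \<open>x0\<close> can put on an
  additional vertex, which is a bound uniform over the ball.
\<close>

lemma ball_over_facet:
  fixes G :: "'a::euclidean_space set"
  assumes G: "convex G" "x0 \<in> G" "aff_dim G = DIM('a) - 1"
    and l: "l \<bullet> a = 1" "\<And>p. p \<in> G \<Longrightarrow> l \<bullet> p = b"
  obtains q r where "r > 0"
    "\<forall>x\<in>ball q r. \<exists>g\<in>G. \<exists>s. 0 \<le> s \<and> s \<le> 1 \<and> x = (1/2) *\<^sub>R (x0 + g) + s *\<^sub>R a"
proof -
  let ?M = "convex hull (insert (x0 + a) G)"
  have "affine hull G \<subseteq> {p. l \<bullet> p = b}"
    by (rule hull_minimal) (use l(2) in \<open>auto simp: affine_hyperplane\<close>)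
  then have "l \<bullet> (x0 + a) = b" if "x0 + a \<in> affine hull G"
    using that by blast
  then have "x0 + a \<notin> affine hull G"
    using l(1) l(2)[OF G(2)] by (auto simp: inner_add_right)
  then have "aff_dim ?M = DIM('a)"
    using G(3) by (simp add: aff_dim_convex_hull aff_dim_insert)
  then have "interior ?M \<noteq> {}"
    using rel_interior_eq_empty[OF convex_convex_hull, of "insert (x0 + a) G"]
    by (simp add: aff_dim_eq_full rel_interior_interior)
  then obtain p r where r: "r > 0" "ball p r \<subseteq> ?M"
    by (metis ex_in_conv mem_interior)
  have "\<exists>g\<in>G. \<exists>s. 0 \<le> s \<and> s \<le> 1 \<and> x = (1/2) *\<^sub>R (x0 + g) + s *\<^sub>R a"
    if x: "x \<in> ball ((1/2) *\<^sub>R (x0 + p)) (r / 2)" for x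
  proof -
    have "p - (2 *\<^sub>R x - x0) = 2 *\<^sub>R ((1/2) *\<^sub>R (x0 + p) - x)"
      by (simp add: algebra_simps)
    then have "dist p (2 *\<^sub>R x - x0) = 2 * dist ((1/2) *\<^sub>R (x0 + p)) x"
      by (simp only: dist_norm norm_scaleR)
    then have "2 *\<^sub>R x - x0 \<in> ?M"
      using x r(2) by auto
    then obtain u w g where g: "0 \<le> u" "0 \<le> w" "u + w = 1" "g \<in> G"
      "2 *\<^sub>R x - x0 = u *\<^sub>R (x0 + a) + w *\<^sub>R g"
      using G(2) hull_same[of convex, OF G(1)] by (subst (asm) convex_hull_insert) auto
    have "u *\<^sub>R x0 + w *\<^sub>R g \<in> G"
      using G g by (intro convexD) auto
    moreover have "x = (1/2) *\<^sub>R (x0 + (u *\<^sub>R x0 + w *\<^sub>R g)) + (u / 2) *\<^sub>R a"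
    proof -
      have "x = (1/2) *\<^sub>R ((2 *\<^sub>R x - x0) + x0)" by (simp add: algebra_simps)
      then show ?thesis unfolding g(5) by (simp add: algebra_simps)
    qed
    moreover have "0 \<le> u / 2" "u / 2 \<le> 1" using g by auto
    ultimately show ?thesis by blast
  qed
  then show thesis using r(1) by (intro that[of "r / 2" "(1/2) *\<^sub>R (x0 + p)"]) auto
qed

text \<open>
  The point \<open>v\<close> lies in the hyperplane \<open>l \<bullet> x = b\<close> that supports the body and already contains the
  \<open>(n - 1)\<close>-dimensional set \<open>G\<close>, a part of \<open>L\<close>. Points of \<open>G\<close> around its relative interior have two
  representations: one inside \<open>L\<close>, and one that gives \<open>v\<close> a positive weight. When \<open>v\<close> moves out, the
  second lifts the upper end of the chord in direction \<open>a\<close>; when \<open>v\<close> moves in, the first keeps it in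
  place. So the sum of the two chord lengths gains a fixed multiple of \<open>t\<close> on a set of lines of
  positive measure, and loses nothing on the other lines.
\<close>

lemma measure_convex_hull_insert_kink:
  fixes L :: "'a::euclidean_space set"
  assumes L: "compact L" "convex L"
    and G: "convex G" "G \<subseteq> L" "aff_dim G = DIM('a) - 1" and v: "v \<in> affine hull G"
    and l: "l \<bullet> a = 1" "\<And>p. p \<in> insert v L \<Longrightarrow> l \<bullet> p \<le> b" "\<And>p. p \<in> G \<Longrightarrow> l \<bullet> p = b"
  obtains \<kappa> where "\<kappa> > 0"
    "\<And>t. t \<ge> 0 \<Longrightarrow> 2 * measure lborel (convex hull (insert v L)) + \<kappa> * t
       \<le> measure lborel (convex hull (insert (v + t *\<^sub>R a) L))
         + measure lborel (convex hull (insert (v - t *\<^sub>R a) L))"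
proof -
  define K where "K t = convex hull (insert (v + t *\<^sub>R a) L)" for t
  have Lne: "L \<noteq> {}" and Gne: "G \<noteq> {}"
    using v G(2) by auto
  have comp: "compact (K t)" for t
    unfolding K_def using L(1) by (intro compact_convex_hull compact_insert)
  have conv: "convex (K t)" for t
    unfolding K_def by simp
  have LK: "L \<subseteq> K t" for t
    unfolding K_def by (meson hull_subset insert_subset)
  have vK: "v + t *\<^sub>R a \<in> K t" for t
    unfolding K_def by (simp add: hull_inc)
  have [measurable]: "K t \<in> sets borel" for t
    using comp by (intro borel_compact)
  have hull_le: "l \<bullet> p \<le> b" if "p \<in> K 0" for p
  proof -
    have "K 0 \<subseteq> {p. l \<bullet> p \<le> b}"
      unfolding K_def by (rule hull_minimal) (use l(2) in \<open>auto simp: convex_halfspace_le\<close>)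
    then show ?thesis using that by auto
  qed
  obtain x0 where x0: "x0 \<in> rel_interior G"
    using rel_interior_eq_empty[OF G(1)] Gne by auto
  then have x0G: "x0 \<in> G" using rel_interior_subset by auto
  \<comment> \<open>The segment from \<open>v\<close> to \<open>x0\<close> can be prolonged inside \<open>G\<close> to a point \<open>l0\<close>, because \<open>x0\<close> is a
    relative interior point; thus \<open>x0\<close> has weight \<open>1 - 1 / m > 0\<close> on \<open>v\<close>.\<close>
  have "\<exists>m. m > 1 \<and> (\<forall>e. e > 1 \<and> e \<le> m \<longrightarrow> (1 - e) *\<^sub>R v + e *\<^sub>R x0 \<in> G)"
    using convex_rel_interior_if[OF G(1) x0] v by (rule bspec)
  then obtain m where m: "m > 1" "(1 - m) *\<^sub>R v + m *\<^sub>R x0 \<in> G"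
    by blast
  define l0 where "l0 = (1 - m) *\<^sub>R v + m *\<^sub>R x0"
  have x0_eq: "x0 = (1 / m) *\<^sub>R l0 + (1 - 1 / m) *\<^sub>R v"
  proof -
    have "(1 / m) *\<^sub>R l0 = x0 - (1 - 1 / m) *\<^sub>R v"
      using m(1) by (simp add: l0_def algebra_simps diff_divide_distrib)
    then show ?thesis by simp
  qed
  define \<epsilon> where "\<epsilon> = (1 - 1 / m) / 2"
  have eps: "\<epsilon> > 0" using m(1) by (simp add: \<epsilon>_def)
  \<comment> \<open>The midpoint of \<open>x0\<close> with a point of \<open>G\<close> puts half the weight of \<open>x0\<close>, namely \<open>\<epsilon>\<close>, on \<open>v\<close>.\<close>
  have lift: "(1/2) *\<^sub>R (x0 + g) + (\<epsilon> * t) *\<^sub>R a \<in> K t" if "g \<in> G" for g t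
  proof -
    have "(1 / m) *\<^sub>R l0 + (1 - 1 / m) *\<^sub>R (v + t *\<^sub>R a) \<in> K t"
      using m LK G(2) vK by (intro convexD[OF conv]) (auto simp: l0_def)
    moreover have "2 * \<epsilon> = 1 - 1 / m" by (simp add: \<epsilon>_def)
    then have "x0 + (2 * \<epsilon> * t) *\<^sub>R a = (1 / m) *\<^sub>R l0 + (1 - 1 / m) *\<^sub>R (v + t *\<^sub>R a)"
      by (subst x0_eq) (simp only: scaleR_add_right add.assoc scaleR_scaleR)
    ultimately have "x0 + (2 * \<epsilon> * t) *\<^sub>R a \<in> K t" by simp
    then have "(1/2) *\<^sub>R (x0 + (2 * \<epsilon> * t) *\<^sub>R a) + (1/2) *\<^sub>R g \<in> K t"
      using that LK G(2) by (intro convexD[OF conv]) auto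
    then show ?thesis by (simp add: algebra_simps)
  qed
  obtain q r where r: "r > 0" and
    over: "\<forall>x\<in>ball q r. \<exists>g\<in>G. \<exists>s. 0 \<le> s \<and> s \<le> 1 \<and> x = (1/2) *\<^sub>R (x0 + g) + s *\<^sub>R a"
    using ball_over_facet[OF G(1) x0G G(3) l(1,3)] by metis
  have pointwise: "2 * chord_length a (K 0) x + ennreal (\<epsilon> * t) * indicator (ball q r) x
      \<le> chord_length a (K t) x + chord_length a (K (- t)) x" if t: "t \<ge> 0" for x t
  proof -
    have shift: "\<exists>k. p + k *\<^sub>R a \<in> K t \<and> p - k *\<^sub>R a \<in> K (- t)" if "p \<in> K 0" for p
    proof -
      have "p \<in> convex hull (insert v L)" using that by (simp add: K_def)
      then obtain k where "\<forall>t. p + (t * k) *\<^sub>R a \<in> convex hull (insert (v + t *\<^sub>R a) L)"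
        using convex_hull_insert_shift[OF L(2) Lne] by blast
      then have "p + (t * k) *\<^sub>R a \<in> K t" "p + (- t * k) *\<^sub>R a \<in> K (- t)"
        unfolding K_def by blast+
      then show ?thesis by auto
    qed
    note sum_ge = chord_length_sum_ge[of "K 0" "K t" "K (- t)" l a x, OF comp conv
        compact_imp_closed[OF comp] conv compact_imp_closed[OF comp] l(1) _ shift]
    show ?thesis
    proof (cases "x \<in> ball q r")
      case True
      obtain g s where g: "g \<in> G" "0 \<le> s" "s \<le> 1" "x = (1/2) *\<^sub>R (x0 + g) + s *\<^sub>R a"
        using bspec[OF over True] by blast
      let ?d = "(1/2) *\<^sub>R (x0 + g)"
      have d: "?d \<in> L"
        using convexD[OF L(2), of x0 g "1/2" "1/2"] x0G g(1) G(2) by (auto simp: scaleR_add_right)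
      have ld: "l \<bullet> ?d = b"
        using l(3)[OF x0G] l(3)[OF g(1)] by (simp add: inner_add_right)
      have "2 * chord_length a (K 0) x + ennreal (\<epsilon> * t)
          \<le> chord_length a (K t) x + chord_length a (K (- t)) x"
      proof (rule sum_ge)
        show "x + (- s) *\<^sub>R a \<in> K 0" using d LK by (auto simp: g(4))
        show "0 \<le> \<epsilon> * t" using eps t by simp
        fix p assume p: "p \<in> K 0" "\<And>s. p + s *\<^sub>R a \<in> K 0 \<Longrightarrow> s \<le> 0" "\<exists>s. p = x + s *\<^sub>R a"
        then obtain s' where s': "p = x + s' *\<^sub>R a" by blast
        \<comment> \<open>The functional \<open>l\<close> is maximal on the body at \<open>?d\<close>, so the chord through \<open>x\<close> ends there.\<close>
        have "p = ?d"
        proof -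
          have "p + (- (s + s')) *\<^sub>R a = ?d" by (simp add: s' g(4) algebra_simps)
          then have "- (s + s') \<le> 0" using p(2)[of "- (s + s')"] d LK by auto
          moreover have "l \<bullet> p = b + (s + s')"
            using ld l(1) by (simp add: s' g(4) inner_add_right)
          ultimately have "s + s' = 0" using hull_le[OF p(1)] by simp
          then show ?thesis by (simp add: s' g(4) add.assoc flip: scaleR_add_left)
        qed
        then have "p + (\<epsilon> * t) *\<^sub>R a \<in> K t" "p + 0 *\<^sub>R a \<in> K (- t)"
          using lift[OF g(1)] d LK by auto
        then show "\<exists>\<mu> \<nu>. p + \<mu> *\<^sub>R a \<in> K t \<and> p + \<nu> *\<^sub>R a \<in> K (- t) \<and> \<mu> + \<nu> = \<epsilon> * t"
          using add_0_right by blast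
      qed
      then show ?thesis using True by simp
    next
      case False
      show ?thesis
      proof (cases "\<exists>s. x + s *\<^sub>R a \<in> K 0")
        case True
        then obtain s where s: "x + s *\<^sub>R a \<in> K 0" by blast
        have "2 * chord_length a (K 0) x + ennreal 0
            \<le> chord_length a (K t) x + chord_length a (K (- t)) x"
        proof (rule sum_ge[OF s])
          fix p assume "p \<in> K 0"
          then obtain k where "p + k *\<^sub>R a \<in> K t" "p - k *\<^sub>R a \<in> K (- t)" using shift by blast
          then show "\<exists>\<mu> \<nu>. p + \<mu> *\<^sub>R a \<in> K t \<and> p + \<nu> *\<^sub>R a \<in> K (- t) \<and> \<mu> + \<nu> = 0"
            by (intro exI[of _ k] exI[of _ "- k"]) auto
        qed auto
        then show ?thesis using False by simp
      qed (use False in \<open>simp add: chord_length_def\<close>)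
    qed
  qed
  define \<kappa> where "\<kappa> = \<epsilon> * measure lborel (ball q r)"
  have "measure lborel (ball q r) > 0"
    using r content_ball_pos[of r q] by (simp add: measure_def)
  then have "\<kappa> > 0" using eps by (simp add: \<kappa>_def)
  moreover have "2 * measure lborel (K 0) + \<kappa> * t \<le> measure lborel (K t) + measure lborel (K (- t))"
    if t: "t \<ge> 0" for t
  proof -
    let ?S = "{x. b \<le> l \<bullet> x \<and> l \<bullet> x \<le> b + 1}"
    have [measurable]: "chord_length a (K t) \<in> borel_measurable borel" for t
    proof -
      have "chord_length a (K t) = (\<lambda>x. \<integral>\<^sup>+ s. indicator (K t) (x + s *\<^sub>R a) \<partial>lborel)"
      proof
        fix x
        have "chord_length a (K t) x = (\<integral>\<^sup>+ s. indicator {s. x + s *\<^sub>R a \<in> K t} s \<partial>lborel)"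
          unfolding chord_length_def by (rule nn_integral_indicator[symmetric]) measurable
        then show "chord_length a (K t) x = (\<integral>\<^sup>+ s. indicator (K t) (x + s *\<^sub>R a) \<partial>lborel)"
          by (simp add: indicator_def)
      qed
      then show ?thesis by simp
    qed
    have em: "emeasure lborel (K t) = ennreal (measure lborel (K t))" for t
      using emeasure_bounded_finite[OF compact_imp_bounded[OF comp[of t]]]
      by (intro emeasure_eq_ennreal_measure) (simp add: less_top)
    have emb: "emeasure lborel (ball q r) = ennreal (measure lborel (ball q r))"
      using emeasure_bounded_finite[OF bounded_ball] by (intro emeasure_eq_ennreal_measure) (simp add: less_top)
    have sub: "ball q r \<subseteq> ?S"
    proof
      fix x assume "x \<in> ball q r"
      then obtain g s where "g \<in> G" "0 \<le> s" "s \<le> 1" "x = (1/2) *\<^sub>R (x0 + g) + s *\<^sub>R a"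
        using over by blast
      then show "x \<in> ?S" using l(1) l(3)[OF x0G] l(3) by (simp add: inner_add_right)
    qed
    have meas: "(\<lambda>x. chord_length a (K t) x * indicator ?S x) \<in> borel_measurable lborel" for t
      by measurable
    have meas_ball: "(\<lambda>x. ennreal (\<epsilon> * t) * indicator (ball q r) x) \<in> borel_measurable lborel"
      by (intro borel_measurable_times_ennreal borel_measurable_const borel_measurable_indicator) auto
    have slab: "(\<integral>\<^sup>+ x. chord_length a (K t) x * indicator ?S x \<partial>lborel) = emeasure lborel (K t)" for t
      by (rule nn_integral_chord_length[OF _ l(1)]) measurable
    have "2 * emeasure lborel (K 0) + ennreal (\<epsilon> * t) * emeasure lborel (ball q r)
      = (\<integral>\<^sup>+ x. 2 * (chord_length a (K 0) x * indicator ?S x) \<partial>lborel)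
        + (\<integral>\<^sup>+ x. ennreal (\<epsilon> * t) * indicator (ball q r) x \<partial>lborel)"
    proof (rule arg_cong2[where f = "(+)"])
      show "2 * emeasure lborel (K 0) = (\<integral>\<^sup>+ x. 2 * (chord_length a (K 0) x * indicator ?S x) \<partial>lborel)"
        by (simp only: nn_integral_cmult[OF meas] slab)
      show "ennreal (\<epsilon> * t) * emeasure lborel (ball q r)
          = (\<integral>\<^sup>+ x. ennreal (\<epsilon> * t) * indicator (ball q r) x \<partial>lborel)"
        by (subst nn_integral_cmult_indicator) auto
    qed
    also have "\<dots> = (\<integral>\<^sup>+ x. 2 * (chord_length a (K 0) x * indicator ?S x)
        + ennreal (\<epsilon> * t) * indicator (ball q r) x \<partial>lborel)"
      by (rule nn_integral_add[symmetric, OF borel_measurable_times_ennreal[OF borel_measurable_const meas] meas_ball])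
    also have "\<dots> \<le> (\<integral>\<^sup>+ x. chord_length a (K t) x * indicator ?S x
        + chord_length a (K (- t)) x * indicator ?S x \<partial>lborel)"
    proof (rule nn_integral_mono)
      fix x
      show "2 * (chord_length a (K 0) x * indicator ?S x) + ennreal (\<epsilon> * t) * indicator (ball q r) x
        \<le> chord_length a (K t) x * indicator ?S x + chord_length a (K (- t)) x * indicator ?S x"
      proof (cases "x \<in> ?S")
        case True
        then show ?thesis using pointwise[OF t, of x] by simp
      next
        case False
        then have "x \<notin> ball q r" using sub by blast
        with False show ?thesis by simp
      qed
    qed
    also have "\<dots> = emeasure lborel (K t) + emeasure lborel (K (- t))"
      by (simp only: nn_integral_add[OF meas meas] slab)
    finally have "2 * ennreal (measure lborel (K 0)) + ennreal (\<epsilon> * t) * ennreal (measure lborel (ball q r))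
        \<le> ennreal (measure lborel (K t)) + ennreal (measure lborel (K (- t)))"
      unfolding em emb .
    moreover have "ennreal (2 * x + e * y) = 2 * ennreal x + ennreal e * ennreal y"
      if "x \<ge> 0" "e \<ge> 0" "y \<ge> 0" for x e y :: real
      using that by (simp only: mult_2 ennreal_plus ennreal_mult add_nonneg_nonneg mult_nonneg_nonneg)
    ultimately have "ennreal (2 * measure lborel (K 0) + (\<epsilon> * t) * measure lborel (ball q r))
        \<le> ennreal (measure lborel (K t) + measure lborel (K (- t)))"
      using eps t by simp
    then have "2 * measure lborel (K 0) + (\<epsilon> * t) * measure lborel (ball q r)
        \<le> measure lborel (K t) + measure lborel (K (- t))"
      by (subst (asm) ennreal_le_iff) auto
    then show ?thesis
      by (simp add: \<kappa>_def mult.assoc mult.commute mult.left_commute)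
  qed
  ultimately show thesis
    using that[of \<kappa>] by (simp add: K_def)
qed

section \<open>Maximal polytopes are simplicial\<close>

text \<open>
  Dividing the product bound by \<open>F0\<close> gives \<open>V t \<le> V0 / (1 - B t / F0)\<close>, which for small \<open>t\<close> is at most
  \<open>V0 * (1 + B t / F0)\<close> up to an error quadratic in \<open>t\<close>. Adding the bounds for \<open>t\<close> and \<open>- t\<close> and
  dividing by \<open>t\<close> leaves \<open>\<kappa>\<close> below a quantity that tends to zero along \<open>t = 1 / (n + 1)\<close>.
\<close>

lemma no_kink_of_bounded_product:
  fixes V B :: "real \<Rightarrow> real"
  assumes pos: "V0 > 0" "F0 > 0"
    and le: "\<And>t. V t * (F0 - B t) \<le> V0 * F0"
    and kink: "\<And>t. t \<ge> 0 \<Longrightarrow> 2 * V0 + \<kappa> * t \<le> V t + V (- t)"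
    and B: "\<And>t. \<bar>B t\<bar> \<le> C * \<bar>t\<bar>"
    and smooth: "(\<lambda>n. (B (inverse (Suc n)) + B (- inverse (Suc n))) / inverse (Suc n)) \<longlonglongrightarrow> 0"
  shows "\<kappa> \<le> 0"
proof -
  define s where "s n = inverse (real (Suc n))" for n
  have s: "s n > 0" for n by (simp add: s_def)
  have s0: "s \<longlonglongrightarrow> 0" unfolding s_def by (rule LIMSEQ_inverse_real_of_nat)
  define D where "D = C / F0"
  have beta: "\<bar>B t / F0\<bar> \<le> D * \<bar>t\<bar>" for t
    using B[of t] pos by (simp add: D_def abs_divide divide_right_mono)
  have V: "V t \<le> V0 * (1 + B t / F0 + 2 * (D * t)\<^sup>2)" if "D * \<bar>t\<bar> \<le> 1 / 2" for t
  proof -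
    define \<beta> where "\<beta> = B t / F0"
    have b: "\<bar>\<beta>\<bar> \<le> D * \<bar>t\<bar>" "\<beta> \<le> 1 / 2" using beta[of t] that abs_ge_self[of "B t / F0"] unfolding \<beta>_def by linarith+
    have "V t * (1 - \<beta>) = V t * (F0 - B t) / F0"
      using pos by (simp add: \<beta>_def field_simps)
    also have "\<dots> \<le> V0" using le[of t] pos by (simp add: pos_divide_le_eq)
    also have "\<dots> \<le> V0 * (1 + \<beta> + 2 * \<beta>\<^sup>2) * (1 - \<beta>)"
    proof -
      \<comment> \<open>This product is at least \<open>1\<close> when \<open>\<beta> \<le> 1 / 2\<close>, so \<open>1 + \<beta> + 2 * \<beta>\<^sup>2\<close> bounds \<open>1 / (1 - \<beta>)\<close>.\<close>
      have "(1 + \<beta> + 2 * \<beta>\<^sup>2) * (1 - \<beta>) = 1 + \<beta>\<^sup>2 * (1 - 2 * \<beta>)"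
        by (simp add: algebra_simps power2_eq_square)
      then have "1 \<le> (1 + \<beta> + 2 * \<beta>\<^sup>2) * (1 - \<beta>)"
        using b by simp
      then have "V0 * 1 \<le> V0 * ((1 + \<beta> + 2 * \<beta>\<^sup>2) * (1 - \<beta>))"
        using pos by (intro mult_left_mono) auto
      then show ?thesis by (simp add: mult.assoc)
    qed
    finally have "V t \<le> V0 * (1 + \<beta> + 2 * \<beta>\<^sup>2)"
      by (rule mult_right_le_imp_le) (use b in auto)
    also have "\<dots> \<le> V0 * (1 + \<beta> + 2 * (D * t)\<^sup>2)"
    proof -
      have "D * \<bar>t\<bar> \<le> \<bar>D * t\<bar>"
        by (simp add: abs_mult mult_right_mono)
      then have "\<beta>\<^sup>2 \<le> (D * t)\<^sup>2"
        using b(1) by (intro abs_le_square_iff[THEN iffD1]) linarith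
      then show ?thesis using pos by simp
    qed
    finally show ?thesis
      by (simp add: \<beta>_def)
  qed
  have "(\<lambda>n. D * s n) \<longlonglongrightarrow> D * 0"
    by (intro tendsto_intros s0)
  then have small: "eventually (\<lambda>n. D * s n < 1 / 2) sequentially"
    by (intro order_tendstoD(2)) auto
  have "eventually (\<lambda>n. \<kappa> \<le> V0 * ((B (s n) + B (- s n)) / s n / F0 + 4 * D\<^sup>2 * s n)) sequentially"
    using small
  proof eventually_elim
    case (elim n)
    have "2 * V0 + \<kappa> * s n \<le> V (s n) + V (- s n)"
      using kink[of "s n"] s[of n] by simp
    also have "\<dots> \<le> V0 * (1 + B (s n) / F0 + 2 * (D * s n)\<^sup>2) + V0 * (1 + B (- s n) / F0 + 2 * (D * (- s n))\<^sup>2)"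
      using elim s[of n] by (intro add_mono V) auto
    also have "\<dots> = 2 * V0 + V0 * ((B (s n) + B (- s n)) / s n / F0 + 4 * D\<^sup>2 * s n) * s n"
      using s[of n] pos by (simp add: field_simps power2_eq_square)
    finally have "\<kappa> * s n \<le> V0 * ((B (s n) + B (- s n)) / s n / F0 + 4 * D\<^sup>2 * s n) * s n"
      by simp
    then show ?case
      by (rule mult_right_le_imp_le) (rule s)
  qed
  moreover have "(\<lambda>n. V0 * ((B (s n) + B (- s n)) / s n / F0 + 4 * D\<^sup>2 * s n)) \<longlonglongrightarrow> V0 * (0 / F0 + 4 * D\<^sup>2 * 0)"
    using smooth pos by (intro tendsto_intros s0) (auto simp: s_def)
  ultimately show ?thesis
    by (auto intro: tendsto_lowerbound)
qed

text \<open>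
  A facet is the convex hull of its vertices, so it is a simplex once they are affinely independent.
  Otherwise one vertex lies in the affine hull of the others, and dropping it keeps the dimension.
\<close>

lemma nonsimplex_facet_vertex:
  fixes K :: "'a::euclidean_space set"
  assumes K: "polytope K" and F: "F facet_of K" and nonsimplex: "\<not> (\<exists>d. d simplex F)"
  obtains v where "v extreme_point_of K" "v \<in> F"
    "v \<in> affine hull ({x. x extreme_point_of F} - {v})"
    "aff_dim ({x. x extreme_point_of F} - {v}) = aff_dim K - 1"
proof -
  let ?C = "{x. x extreme_point_of F}"
  have face: "F face_of K" using F by (rule facet_of_imp_face_of)
  have "compact F" "convex F"
    using face K face_of_imp_compact face_of_imp_convex polytope_imp_compact polytope_imp_convex by blast+
  then have F_hull: "F = convex hull ?C"
    by (rule Krein_Milman_Minkowski)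
  have "affine_dependent ?C"
  proof (rule ccontr)
    assume "\<not> affine_dependent ?C"
    then have "(int (card ?C) - 1) simplex F"
      unfolding simplex_def using F_hull by auto
    then show False using nonsimplex by blast
  qed
  then obtain v where v: "v \<in> ?C" "v \<in> affine hull (?C - {v})"
    unfolding affine_dependent_def by blast
  have "aff_dim K - 1 = aff_dim ?C"
    using F F_hull aff_dim_convex_hull[of ?C] by (simp add: facet_of_def)
  also have "\<dots> = aff_dim (insert v (?C - {v}))"
    using v(1) by (simp add: insert_absorb)
  also have "\<dots> = aff_dim (?C - {v})"
    using v(2) by (simp only: aff_dim_insert if_True)
  finally show thesis
    using that[of v] v face extreme_point_of_face[OF face, of v] by auto
qed

lemma moved_vertex_polytope:
  fixes S :: "(real^'n) set"
  assumes "finite S" "v \<notin> S" "card (insert v S) \<le> m" "interior (convex hull S) \<noteq> {}"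
  shows "convex hull (insert w (convex hull S)) \<in> polytopes_at_most m"
proof -
  have eq: "convex hull (insert w (convex hull S)) = convex hull (insert w S)"
    by (rule hull_insert[symmetric])
  have "polytope (convex hull (insert w S))"
    using assms(1) by (intro polytope_convex_hull) simp
  moreover have "interior (convex hull (insert w S)) \<noteq> {}"
    using assms(4) interior_mono[OF hull_mono[of S "insert w S" convex]] by auto
  moreover have "card {x. x extreme_point_of convex hull (insert w S)} \<le> card (insert w S)"
    using assms(1) by (intro card_mono) (auto dest: extreme_point_of_convex_hull)
  moreover have "card (insert w S) \<le> card (insert v S)"
    using assms(1,2) by (simp add: card_insert_if)
  ultimately show ?thesis
    using assms(3) unfolding eq polytopes_at_most_def by auto
qed

theorem theorem3p4:
  fixes K :: "(real^'n) set" and m :: nat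
  assumes "m \<ge> CARD('n) + 1"
    and "K \<in> polytopes_at_most m"
    and "\<forall>K' \<in> (polytopes_at_most m :: (real^'n) set set). volume_product K \<ge> volume_product K'"
  shows "simplicial_polytope K"
proof -
  have K: "polytope K" "interior K \<noteq> {}" "card {v. v extreme_point_of K} \<le> m"
    using assms(2) by (auto simp: polytopes_at_most_def)
  have compK: "compact K" and convK: "convex K"
    using K(1) polytope_imp_compact polytope_imp_convex by blast+
  have False if F: "F facet_of K" and nonsimplex: "\<not> (\<exists>d. d simplex F)" for F
  proof -
    obtain v where v: "v extreme_point_of K" "v \<in> F"
      "v \<in> affine hull ({x. x extreme_point_of F} - {v})"
      "aff_dim ({x. x extreme_point_of F} - {v}) = aff_dim K - 1"
      by (rule nonsimplex_facet_vertex[OF K(1) F nonsimplex])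
    define C where "C = {x. x extreme_point_of F} - {v}"
    define S where "S = {x. x extreme_point_of K} - {v}"
    define L where "L = convex hull S"
    have finV: "finite {x. x extreme_point_of K}"
      using K(1) by (intro finite_polyhedron_extreme_points polytope_imp_polyhedron)
    have S: "finite S" "v \<notin> S" "insert v S = {x. x extreme_point_of K}"
      using finV v(1) by (auto simp: S_def)
    have CF: "C \<subseteq> F" and CS: "C \<subseteq> S"
      using extreme_point_of_face[OF facet_of_imp_face_of[OF F]]
      by (auto simp: C_def S_def extreme_point_of_def)
    have Sne: "S \<noteq> {}"
      using v(3) CS unfolding C_def[symmetric] by auto
    have hullK: "convex hull (insert v L) = K"
      using Krein_Milman_Minkowski[OF compK convK] S(3) hull_insert[of convex v S] by (simp add: L_def)
    have dimK: "aff_dim K = DIM(real^'n)"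
      using K(2) by (rule aff_dim_nonempty_interior)
    have "aff_dim (insert v S) = DIM(real^'n)"
      using dimK hullK hull_insert[of convex v S] aff_dim_convex_hull[of "insert v S"] by (simp add: L_def)
    moreover have "v \<in> affine hull S"
      using v(3) hull_mono[OF CS, of affine] by (auto simp: C_def)
    ultimately have "aff_dim L = DIM(real^'n)"
      by (simp add: aff_dim_insert aff_dim_convex_hull L_def)
    then have intL: "interior L \<noteq> {}"
      using rel_interior_eq_empty[of L] Sne unfolding aff_dim_eq_full
      by (simp add: L_def rel_interior_interior)
    obtain a b where a: "a \<noteq> 0" "K \<subseteq> {x. a \<bullet> x \<le> b}" "F = K \<inter> {x. a \<bullet> x = b}"
      by (rule facet_of_polyhedron[OF polytope_imp_polyhedron[OF K(1)] F])
    define K' where "K' t = convex hull (insert (v + t *\<^sub>R a) L)" for t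
    have K'0: "K' 0 = K" using hullK by (simp add: K'_def)
    have K'_poly: "K' t \<in> polytopes_at_most m" for t
      unfolding K'_def L_def using S K(3) intL
      by (intro moved_vertex_polytope[of S v]) (auto simp: L_def)
    have compK': "compact (K' t)" and intK': "interior (K' t) \<noteq> {}" for t
      using K'_poly[of t] polytope_imp_compact by (auto simp: polytopes_at_most_def)
    have a_pos: "a \<bullet> a > 0" using a(1) by simp
    \<comment> \<open>The direction \<open>a\<close> is the outer normal of the facet; the functional is scaled to take the value \<open>1\<close>
      on it.\<close>
    have below: "inverse (a \<bullet> a) *\<^sub>R a \<bullet> p \<le> b / (a \<bullet> a)" if "p \<in> insert v L" for p
    proof -
      have "p \<in> K" unfolding hullK[symmetric] using that by (rule hull_inc)
      then have "a \<bullet> p \<le> b" using a(2) by auto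
      then show ?thesis using a_pos by (simp add: field_simps)
    qed
    have on_F: "inverse (a \<bullet> a) *\<^sub>R a \<bullet> p = b / (a \<bullet> a)" if "p \<in> convex hull C" for p
    proof -
      have "convex F" using F facet_of_imp_face_of face_of_imp_convex by blast
      then have "convex hull C \<subseteq> F" by (rule hull_minimal[OF CF])
      then have "a \<bullet> p = b" using that a(3) by auto
      then show ?thesis using a_pos by (simp add: field_simps)
    qed
    have compL: "compact L" and convL: "convex L"
      using S(1) by (auto simp: L_def intro: finite_imp_compact_convex_hull)
    have G: "convex hull C \<subseteq> L" "aff_dim (convex hull C) = DIM(real^'n) - 1"
      "v \<in> affine hull (convex hull C)"
      unfolding L_def using hull_mono[OF CS] v(3,4) dimK
      by (simp_all add: C_def[symmetric] aff_dim_convex_hull affine_hull_convex_hull)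
    have l: "inverse (a \<bullet> a) *\<^sub>R a \<bullet> a = 1" using a(1) by simp
    obtain \<kappa> where kappa: "\<kappa> > 0"
      "\<forall>t\<ge>0. 2 * measure lborel K + \<kappa> * t \<le> measure lborel (K' t) + measure lborel (K' (- t))"
      using measure_convex_hull_insert_kink[OF compL convL convex_convex_hull G l below on_F]
      unfolding hullK K'_def by (metis diff_conv_add_uminus scaleR_minus_left)
    obtain z0 where z0: "z0 \<in> interior K"
      "\<And>z. z \<in> interior K \<Longrightarrow> (\<integral>y. polar_weight K z0 y \<partial>lborel) \<le> (\<integral>y. polar_weight K z y \<partial>lborel)"
      using polar_weight_integral_minimiser[OF compK convK K(2)] by blast
    have crit: "(\<integral>y. (e \<bullet> y) * polar_weight K z0 y \<partial>lborel) = 0" for e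
      by (rule polar_weight_first_moment[OF compK z0])
    define B where
      "B t = (\<integral>y. (support_fun (K' t) y - support_fun K y) * polar_weight K z0 y \<partial>lborel)" for t
    define F0 where "F0 = (\<integral>y. polar_weight K z0 y \<partial>lborel)"
    have B_eq: "B t = (\<integral>y. (support_fun (convex hull (insert (v + t *\<^sub>R a) (convex hull S))) y
        - support_fun (convex hull (insert v (convex hull S))) y) * polar_weight K z0 y \<partial>lborel)" for t
      using hullK by (simp add: B_def K'_def L_def)
    obtain C' where C': "\<And>t. \<bar>B t\<bar> \<le> C' * \<bar>t\<bar>"
      using moved_vertex_dual_smooth(1)[OF S(1) Sne S(2) compK z0(1), of a] unfolding B_eq by blast
    have smooth: "(\<lambda>n. (B (inverse (Suc n)) + B (- inverse (Suc n))) / inverse (Suc n)) \<longlonglongrightarrow> 0"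
      using moved_vertex_dual_smooth(2)[OF S(1) Sne S(2) compK z0(1), of a] unfolding B_eq .
    have F0: "F0 > 0"
    proof -
      have "F0 \<noteq> 0"
      proof
        assume "F0 = 0"
        then have "AE y in lborel. polar_weight K z0 y = 0"
          using integrable_polar_weight[OF compK z0(1)] integral_nonneg_eq_0_iff_AE[of lborel "polar_weight K z0"]
          by (simp add: F0_def)
        then have "AE y in (lborel :: (real^'n) measure). False"
          by (rule eventually_mono) (metis less_irrefl polar_weight_pos)
        then show False
          by (simp add: eventually_False ae_filter_eq_bot_iff)
      qed
      then show ?thesis
        unfolding F0_def by (simp add: less_le integral_nonneg_AE)
    qed
    have V0: "measure lborel K > 0"
    proof -
      have "measure lebesgue K \<noteq> 0"
        using K(2) compK negligible_iff_measure0 open_not_negligible[of "interior K"]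
          negligible_subset[OF _ interior_subset] lmeasurable_compact by (metis open_interior)
      then show ?thesis by (simp add: measure_lebesgue_compact[OF compK] less_le)
    qed
    have "measure lborel (K' t) * (F0 - B t) \<le> measure lborel K * F0" for t
    proof -
      have "measure lborel (K' t) * ((F0 - B t) / fact CARD('n)) \<le> volume_product (K' t)"
        unfolding F0_def B_def by (rule volume_product_ge[OF compK z0(1) crit compK' intK'])
      also have "\<dots> \<le> volume_product K" using assms(3) K'_poly by blast
      also have "\<dots> \<le> measure lborel K * (F0 / fact CARD('n))"
        unfolding F0_def by (rule volume_product_le[OF compK z0(1)])
      finally show ?thesis by (simp add: divide_le_cancel)
    qed
    \<comment> \<open>The volume has a kink of positive size \<open>\<kappa>\<close> at \<open>t = 0\<close>, which maximality excludes.\<close>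
    from no_kink_of_bounded_product[OF V0 F0 this kappa(2)[rule_format] C' smooth] kappa(1)
    show False by simp
  qed
  then show ?thesis
    using K(1) unfolding simplicial_polytope_def by blast
qed

end
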